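(* Let $n,d\geq1$ be integers, let $a\in\mathcal{S}^{(1)'}(\mathbb{R}^{2nd})$ and let $\varphi=(\vec\varphi,\vec\phi)$, where $\vec\varphi=(\varphi_1,\dots,\varphi_n)$, $\vec\phi=(\phi_1,\dots,\phi_n)$ and $\varphi_j,\phi_j\in\mathcal{S}^{(1)}(\mathbb{R}^d)$, $j=1,\dots,n$. Then the multilinear localization operator $A_a^{\varphi}$ is the multilinear Weyl pseudodifferential operator with the Weyl symbol $$\sigma=a\ast W(\vec\phi,\vec\varphi)=a\ast\Big(\prod_{j=1}^n W(\phi_j,\varphi_j)\Big).$$ Therefore, if $\vec f=(f_1,\dots,f_n)$ and $\vec g=(g_1,\dots,g_n)$ with $f_j,g_j\in\mathcal{S}^{(1)}(\mathbb{R}^d)$, $j=1,\dots,n$, then $$\langle A_a^{\varphi}\vec f,\vec g\rangle=\langle L_{a\ast W(\vec\phi,\vec\varphi)}\vec f,\vec g\rangle .$$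
   Context: For $m\geq1$, the Gelfand--Shilov space $\mathcal{S}^{(1)}(\mathbb{R}^m)$ consists of all functions $f$ on $\mathbb{R}^m$ such that $\|f(x)e^{h|x|}\|_{L^\infty}<\infty$ and $\|\hat f(\omega)e^{h|\omega|}\|_{L^\infty}<\infty$ for every $h>0$, with the topology given by these norms; here $\hat f(\omega)=\int f(t)e^{-2\pi i t\cdot\omega}\,dt$. Its dual is denoted $\mathcal{S}^{(1)'}(\mathbb{R}^m)$. The bracket $\langle\cdot,\cdot\rangle$ denotes the extension of the $L^2$ inner product $\langle f,g\rangle=\int f(t)\overline{g(t)}\,dt$ to pairs of dual spaces, and $\ast$ denotes convolution (here on $\mathbb{R}^{2nd}$, extended to $\mathcal{S}^{(1)'}\ast\mathcal{S}^{(1)}$). Points of $\mathbb{R}^{nd}$ are written $x=(x_1,\dots,x_n)$ with $x_j\in\mathbb{R}^d$, and $x\cdot\omega=\sum_{j=1}^n x_j\cdot\omega_j$. A vector $\vec f=(f_1,\dots,f_n)$ is identified with the tensor product $\vec f(t)=\prod_{j=1}^n f_j(t_j)$, $t=(t_1,\dots,t_n)$. Translation and modulation: $T_xf(\cdot)=f(\cdot-x)$, $M_\omega f(\cdot)=e^{2\pi i\omega\cdot}f(\cdot)$, $x,\omega\in\mathbb{R}^d$. Short-time Fourier transform: $V_gf(x,\omega)=\langle f,M_\omega T_xg\rangle=\int_{\mathbb{R}^d}f(t)\overline{g(t-x)}e^{-2\pi i\omega\cdot t}\,dt$. For vectors, $V_{\vec\varphi}\vec f(x,\omega)=\int_{\mathbb{R}^{nd}}\vec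 f(t)\prod_{j=1}^n\overline{M_{\omega_j}T_{x_j}\varphi_j(t_j)}\,dt$, $x,\omega\in\mathbb{R}^{nd}$. Multilinear localization operator: for a symbol $a\in\mathcal{S}^{(1)'}(\mathbb{R}^{2nd})$ and window $\varphi=(\vec\varphi,\vec\phi)$, $$A_a^{\varphi}\vec f(t)=\int_{\mathbb{R}^{2nd}}a(x,\omega)\prod_{j=1}^n\big(V_{\varphi_j}f_j(x_j,\omega_j)\,M_{\omega_j}T_{x_j}\phi_j(t_j)\big)\,dx\,d\omega,$$ interpreted weakly as $\langle A_a^{\varphi}\vec f,\vec g\rangle=\langle a\,V_{\vec\varphi}\vec f,V_{\vec\phi}\vec g\rangle=\langle a,\overline{V_{\vec\varphi}\vec f}\,V_{\vec\phi}\vec g\rangle$ for $f_j,g_j\in\mathcal{S}^{(1)}(\mathbb{R}^d)$. Wigner transform: $W(f,g)(x,\omega)=\int_{\mathbb{R}^d}f(x+\frac t2)\overline{g(x-\frac t2)}e^{-2\pi i\omega\cdot t}\,dt$ for $f,g\in\mathcal{S}^{(1)}(\mathbb{R}^d)$. Multilinear Wigner transform: $W(\vec f,\vec g)(x,\omega)=\int_{\mathbb{R}^{nd}}\prod_{j=1}^n\big(f_j(x_j+\frac{t_j}2)\overline{g_j(x_j-\frac{t_j}2)}\big)e^{-2\pi i\omega\cdot t}\,dt=\prod_{j=1}^nW(f_j,g_j)(x_j,\omega_j)$, $x,\omega\in\mathbb{R}^{nd}$. Multilinear Weyl pseudodifferential operator with Weyl symbol $\sigma\in\mathcal{S}^{(1)'}(\mathbb{R}^{2nd})$: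 $$L_\sigma(\vec f)(x)=\int_{\mathbb{R}^{2nd}}\sigma\Big(\frac{x+y}2,\omega\Big)\vec f(y)e^{2\pi i(x-y)\cdot\omega}\,dy\,d\omega,\qquad x\in\mathbb{R}^{nd},$$ interpreted weakly by $\langle L_\sigma\vec f,\vec g\rangle=\langle\sigma,W(\vec g,\vec f)\rangle$ for $f_j,g_j\in\mathcal{S}^{(1)}(\mathbb{R}^d)$. *)

theory Defs
  imports "HOL-Analysis.Analysis"
begin

text \<open>
  The space \<open>\<real>\<^sup>d\<close> is rendered as \<^typ>\<open>real ^ 'd\<close>, \<open>\<real>\<^sup>n\<^sup>d\<close> as \<^typ>\<open>real ^ 'd ^ 'n\<close> (so that
  \<open>x $ j\<close> is the block \<open>x\<^sub>j\<close> and \<open>x \<bullet> y = (\<Sum>j\<in>UNIV. x $ j \<bullet> y $ j)\<close>), and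
  \<open>\<real>\<^sup>2\<^sup>n\<^sup>d\<close> as \<^typ>\<open>(real ^ 'd ^ 'n) \<times> (real ^ 'd ^ 'n)\<close> with elements \<open>(x, \<omega>)\<close>.
  The index types are finite and nonempty, so \<open>n, d \<ge> 1\<close>.
\<close>

definition fourier :: "('a::euclidean_space \<Rightarrow> complex) \<Rightarrow> 'a \<Rightarrow> complex" where
  "fourier f \<omega> = (\<integral>t. f t * exp (- 2 * pi * \<i> * of_real (t \<bullet> \<omega>)) \<partial>lborel)"

subsection \<open>The Gelfand--Shilov space of Beurling type and its dual\<close>

text \<open>
  Exponential decay of \<open>f\<close> and of its Fourier transform forces \<open>f\<close> to agree almost everywhere with
  a continuous function. Elements of the space are taken to be these continuous representatives,
  for which the \<open>L\<^sup>\<infinity>\<close> norm is the supremum.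
\<close>

definition GS :: "('a::euclidean_space \<Rightarrow> complex) set" where
  "GS = {f. continuous_on UNIV f \<and>
            (\<forall>h>0. bounded (range (\<lambda>x. f x * of_real (exp (h * norm x))))) \<and>
            (\<forall>h>0. bounded (range (\<lambda>\<omega>. fourier f \<omega> * of_real (exp (h * norm \<omega>)))))}"

definition exp_norm :: "real \<Rightarrow> ('a::euclidean_space \<Rightarrow> complex) \<Rightarrow> real" where
  "exp_norm h f = (SUP x. norm (f x * of_real (exp (h * norm x))))"

definition GS_topology :: "('a::euclidean_space \<Rightarrow> complex) topology" where
  "GS_topology = topology_generated_by
     ({{g \<in> GS. exp_norm h (\<lambda>x. g x - f x) < \<epsilon>} | f h \<epsilon>. f \<in> GS \<and> h > 0 \<and> \<epsilon> > 0} \<union>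
      {{g \<in> GS. exp_norm h (fourier (\<lambda>x. g x - f x)) < \<epsilon>} | f h \<epsilon>. f \<in> GS \<and> h > 0 \<and> \<epsilon> > 0})"

text \<open>
  The dual consists of the continuous linear functionals on \<^const>\<open>GS\<close>; their values outside
  \<^const>\<open>GS\<close> are irrelevant. A function \<open>f\<close> is identified with \<open>\<lambda>\<psi>. \<integral>x. f x * \<psi> x \<partial>lborel\<close>.
\<close>

definition GS_dual :: "(('a::euclidean_space \<Rightarrow> complex) \<Rightarrow> complex) set" where
  "GS_dual = {u. (\<forall>f\<in>GS. \<forall>g\<in>GS. u (\<lambda>x. f x + g x) = u f + u g) \<and>
                 (\<forall>c. \<forall>f\<in>GS. u (\<lambda>x. c * f x) = c * u f) \<and>
                 continuous_map GS_topology euclidean u}"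

text \<open>
  The bracket extends the inner product \<open>\<integral>t. f t * cnj (g t) \<partial>lborel\<close>, so it is linear in the
  distribution and antilinear in the test function.
\<close>

definition bracket :: "(('a \<Rightarrow> complex) \<Rightarrow> complex) \<Rightarrow> ('a \<Rightarrow> complex) \<Rightarrow> complex" where
  "bracket u g = u (\<lambda>x. cnj (g x))"

text \<open>
  Convolution of a distribution and a test function, by transposition: if \<open>u\<close> is given by a
  function, then \<open>\<integral>x. (\<integral>y. u y * \<Phi> (x - y)) * \<psi> x = \<integral>y. u y * (\<integral>x. \<Phi> (x - y) * \<psi> x)\<close>.
\<close>

definition GS_conv ::
  "(('a::euclidean_space \<Rightarrow> complex) \<Rightarrow> complex) \<Rightarrow> ('a \<Rightarrow> complex) \<Rightarrow> ('a \<Rightarrow> complex) \<Rightarrow> complex" where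
  "GS_conv u \<Phi> = (\<lambda>\<psi>. u (\<lambda>y. \<integral>x. \<Phi> (x - y) * \<psi> x \<partial>lborel))"

subsection \<open>Time-frequency transforms\<close>

definition tensor :: "('n::finite \<Rightarrow> real ^ 'd \<Rightarrow> complex) \<Rightarrow> real ^ 'd ^ 'n \<Rightarrow> complex" where
  "tensor f t = (\<Prod>j\<in>UNIV. f j (t $ j))"

definition translation :: "'a::euclidean_space \<Rightarrow> ('a \<Rightarrow> complex) \<Rightarrow> 'a \<Rightarrow> complex" where
  "translation x f = (\<lambda>t. f (t - x))"

definition modulation :: "'a::euclidean_space \<Rightarrow> ('a \<Rightarrow> complex) \<Rightarrow> 'a \<Rightarrow> complex" where
  "modulation \<omega> f = (\<lambda>t. exp (2 * pi * \<i> * of_real (\<omega> \<bullet> t)) * f t)"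

text \<open>
  The multilinear short-time Fourier transform of a vector \<open>f\<close> is \<open>multi_stft \<phi> (tensor f)\<close>.
\<close>

definition multi_stft ::
  "('n::finite \<Rightarrow> real ^ 'd::finite \<Rightarrow> complex) \<Rightarrow> (real ^ 'd ^ 'n \<Rightarrow> complex) \<Rightarrow>
   (real ^ 'd ^ 'n) \<times> (real ^ 'd ^ 'n) \<Rightarrow> complex" where
  "multi_stft \<phi> F = (\<lambda>(x, \<omega>).
     \<integral>t. F t * (\<Prod>j\<in>UNIV. cnj (modulation (\<omega> $ j) (translation (x $ j) (\<phi> j)) (t $ j))) \<partial>lborel)"

text \<open>
  For vectors \<open>f\<close>, \<open>g\<close> the multilinear Wigner transform is \<open>wigner (tensor f) (tensor g)\<close>, taken on
  \<^typ>\<open>real ^ 'd ^ 'n\<close>.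
\<close>

definition wigner ::
  "('a::euclidean_space \<Rightarrow> complex) \<Rightarrow> ('a \<Rightarrow> complex) \<Rightarrow> 'a \<times> 'a \<Rightarrow> complex" where
  "wigner f g = (\<lambda>(x, \<omega>).
     \<integral>t. f (x + t /\<^sub>R 2) * cnj (g (x - t /\<^sub>R 2)) * exp (- 2 * pi * \<i> * of_real (\<omega> \<bullet> t)) \<partial>lborel)"

subsection \<open>The operators\<close>

text \<open>
  Both operators send a vector of functions to a linear functional on test functions on \<open>\<real>\<^sup>n\<^sup>d\<close>.
  The conjugation of \<open>\<psi>\<close> undoes the one in \<^const>\<open>bracket\<close>; the resulting weak formulas are
  stated after each definition, for an arbitrary \<open>G\<close> in place of a tensor product.
\<close>

definition loc_op ::
  "((((real ^ 'd::finite ^ 'n::finite) \<times> (real ^ 'd ^ 'n)) \<Rightarrow> complex) \<Rightarrow> complex) \<Rightarrow>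
   ('n \<Rightarrow> real ^ 'd \<Rightarrow> complex) \<Rightarrow> ('n \<Rightarrow> real ^ 'd \<Rightarrow> complex) \<Rightarrow>
   ('n \<Rightarrow> real ^ 'd \<Rightarrow> complex) \<Rightarrow> (real ^ 'd ^ 'n \<Rightarrow> complex) \<Rightarrow> complex" where
  "loc_op a \<phi>1 \<phi>2 f = (\<lambda>\<psi>.
     bracket a (\<lambda>z. cnj (multi_stft \<phi>1 (tensor f) z) * multi_stft \<phi>2 (\<lambda>t. cnj (\<psi> t)) z))"

lemma bracket_loc_op:
  "bracket (loc_op a \<phi>1 \<phi>2 f) G =
     bracket a (\<lambda>z. cnj (multi_stft \<phi>1 (tensor f) z) * multi_stft \<phi>2 G z)"
  by (simp add: loc_op_def bracket_def)

definition weyl_op ::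
  "((((real ^ 'd::finite ^ 'n::finite) \<times> (real ^ 'd ^ 'n)) \<Rightarrow> complex) \<Rightarrow> complex) \<Rightarrow>
   ('n \<Rightarrow> real ^ 'd \<Rightarrow> complex) \<Rightarrow> (real ^ 'd ^ 'n \<Rightarrow> complex) \<Rightarrow> complex" where
  "weyl_op \<sigma> f = (\<lambda>\<psi>. bracket \<sigma> (wigner (\<lambda>t. cnj (\<psi> t)) (tensor f)))"

lemma bracket_weyl_op:
  "bracket (weyl_op \<sigma> f) G = bracket \<sigma> (wigner G (tensor f))"
  by (simp add: weyl_op_def bracket_def)

end

theory Submission
  imports Defs "HOL-Probability.Characteristic_Functions" "HOL-Probability.Sinc_Integral"
begin

text \<open>
  Write \<open>\<pi> (p, q)\<close> for the time-frequency shift \<open>modulation q \<circ> translation p\<close>.  The short-time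
  Fourier transform at \<open>y\<close> is the inner product \<open>V\<^sub>\<phi> F y = \<langle>F, \<pi> y \<phi>\<rangle>\<close>.  Two classical facts about the Wigner transform
  therefore give the identity of the two operators:

  \<^item> covariance, \<open>W (f, g) (z - y) = W (\<pi> y f, \<pi> y g) z\<close> (\<open>wigner_covariance\<close>);
  \<^item> Moyal's identity, \<open>\<langle>W (f1, f2), W (g1, g2)\<rangle> = \<langle>f1, g1\<rangle> cnj \<langle>f2, g2\<rangle>\<close> (\<open>wigner_moyal\<close>).

  The Weyl operator with symbol \<open>a \<star> \<Phi>\<close>, \<open>\<Phi> = W (\<phi>2, \<phi>1)\<close>, is by transposition the value of \<open>a\<close> at
  the function \<open>y \<mapsto> \<integral>z. \<Phi> (z - y) * cnj (W (G, f) z)\<close>.  By covariance the integral is an inner product of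
  two Wigner transforms, and by Moyal's identity it equals \<open>V\<^sub>\<phi>\<^sub>1 f y * cnj (V\<^sub>\<phi>\<^sub>2 G y)\<close>, which
  is the function at which the localization operator evaluates \<open>a\<close> (\<open>reflected_conv_wigner\<close>).
  The agreement is pointwise, before \<open>a\<close> is applied.

  Two things remain.  The symbol has to be meaningful: \<open>\<Phi>\<close> lies in the Gelfand--Shilov space
  (\<open>GS_tensor\<close>, \<open>GS_wigner\<close>), and convolution with \<open>\<Phi>\<close> is continuous on that space and so maps
  the dual to itself (\<open>GS_conv_dual\<close>).  Moreover \<open>\<Phi>\<close> has to be the product of the Wigner transforms of the
  components, which is Fubini's theorem for \<open>\<real>\<^sup>n\<^sup>d\<close> as an \<open>n\<close>-fold product (\<open>wigner_tensor\<close>).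

  The analytic tool behind all of this is Fourier inversion on a Euclidean space, proved by Gaussian
  summation.  It yields Parseval's identity, from which Moyal's identity follows.  It also yields
  that the Wigner transform of \<open>f, g\<close> is a rotated copy of the Wigner transform of their Fourier
  transforms (\<open>wigner_fourier\<close>), so that exponential decay in the frequency variable reduces to
  decay in the position variable, which is elementary.
\<close>

section \<open>Integration on Euclidean spaces\<close>

lemma integral_lborel_affine:
  fixes f :: "'a::euclidean_space \<Rightarrow> 'b::{banach, second_countable_topology}"
  assumes [measurable]: "f \<in> borel_measurable borel" and c: "c \<noteq> 0"
  shows "(\<integral>x. f x \<partial>lborel) = \<bar>c\<bar> ^ DIM('a) *\<^sub>R (\<integral>x. f (t + c *\<^sub>R x) \<partial>lborel)"
  by (subst lborel_affine[OF c, of t])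
     (simp add: integral_density integral_distr)

lemma integrable_lborel_affine:
  fixes f :: "'a::euclidean_space \<Rightarrow> 'b::{banach, second_countable_topology}"
  assumes f: "integrable lborel f" and c: "c \<noteq> 0"
  shows "integrable lborel (\<lambda>x. f (t + c *\<^sub>R x))"
proof -
  have [measurable]: "f \<in> borel_measurable borel"
    using borel_measurable_integrable[OF f] by simp
  have "integrable (density (distr lborel borel (\<lambda>x. t + c *\<^sub>R x)) (\<lambda>_. ennreal (\<bar>c\<bar> ^ DIM('a)))) f"
    using f by (subst (asm) lborel_affine[OF c, of t]) (simp add: ennreal_power)
  then have "integrable lborel (\<lambda>x. \<bar>c\<bar> ^ DIM('a) *\<^sub>R f (t + c *\<^sub>R x))"
    by (simp add: integrable_density integrable_distr_eq)
  then have "integrable lborel (\<lambda>x. inverse (\<bar>c\<bar> ^ DIM('a)) *\<^sub>R \<bar>c\<bar> ^ DIM('a) *\<^sub>R f (t + c *\<^sub>R x))"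
    by (rule integrable_scaleR_right)
  then show ?thesis
    using c by simp
qed

lemma
  fixes F :: "'a::euclidean_space \<times> 'b::euclidean_space \<Rightarrow> complex"
  assumes F: "integrable lborel F"
  shows integral_lborel_pair: "(\<integral>z. F z \<partial>lborel) = (\<integral>x. (\<integral>y. F (x, y) \<partial>lborel) \<partial>lborel)"
    and integral_lborel_swap:
      "(\<integral>x. (\<integral>y. F (x, y) \<partial>lborel) \<partial>lborel) = (\<integral>y. (\<integral>x. F (x, y) \<partial>lborel) \<partial>lborel)"
proof -
  have F': "integrable (lborel \<Otimes>\<^sub>M lborel) F" using F by (simp add: lborel_prod)
  show "(\<integral>z. F z \<partial>lborel) = (\<integral>x. (\<integral>y. F (x, y) \<partial>lborel) \<partial>lborel)"
    using lborel_pair.integral_fst'[OF F'] by (simp add: lborel_prod)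
  show "(\<integral>x. (\<integral>y. F (x, y) \<partial>lborel) \<partial>lborel) = (\<integral>y. (\<integral>x. F (x, y) \<partial>lborel) \<partial>lborel)"
    using lborel_pair.Fubini_integral[of "\<lambda>x y. F (x, y)"] F' by simp
qed

text \<open>
  Most uses of Fubini's theorem below concern integrands that are dominated by a product of
  integrable functions of one variable each.
\<close>

lemma integrable_lborel_pair_bound:
  fixes F :: "'a::euclidean_space \<times> 'b::euclidean_space \<Rightarrow> complex"
  assumes F: "F \<in> borel_measurable (borel \<Otimes>\<^sub>M borel)"
    and A: "integrable lborel A" and B: "integrable lborel (B :: 'b \<Rightarrow> real)"
    and le: "\<And>x y. norm (F (x, y)) \<le> A x * B y"
  shows "integrable lborel F"
proof -
  have [measurable]: "A \<in> borel_measurable borel" "B \<in> borel_measurable borel"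
    using borel_measurable_integrable[OF A] borel_measurable_integrable[OF B] by simp_all
  have [measurable]: "F \<in> borel_measurable borel" using F by (simp add: borel_prod)
  have "integrable (lborel \<Otimes>\<^sub>M lborel) (\<lambda>z. A (fst z) * B (snd z))"
    by (rule lborel_pair.Fubini_integrable) (use A B in \<open>auto simp: abs_mult\<close>)
  then have "integrable lborel (\<lambda>z. A (fst z) * B (snd z))" by (simp add: lborel_prod)
  then show ?thesis
    by (rule Bochner_Integration.integrable_bound) (auto intro!: AE_I2 order.trans[OF le])
qed

lemma continuous_on_integral_dominated:
  fixes F :: "'a::metric_space \<Rightarrow> 'b::euclidean_space \<Rightarrow> complex"
  assumes cont: "\<And>t. continuous_on UNIV (\<lambda>z. F z t)"
    and meas: "\<And>z. F z \<in> borel_measurable borel"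
    and w: "integrable lborel w" and le: "\<And>z t. norm (F z t) \<le> w t"
  shows "continuous_on UNIV (\<lambda>z. \<integral>t. F z t \<partial>lborel)"
  unfolding continuous_on_sequentially
proof (intro allI ballI impI, elim conjE)
  fix s :: "nat \<Rightarrow> 'a" and z assume s: "s \<longlonglongrightarrow> z"
  have "(\<lambda>i. \<integral>t. F (s i) t \<partial>lborel) \<longlonglongrightarrow> (\<integral>t. F z t \<partial>lborel)"
  proof (rule integral_dominated_convergence[where w=w])
    have "(\<lambda>i. F (s i) t) \<longlonglongrightarrow> F z t" for t
      by (rule continuous_on_tendsto_compose[OF cont[of t] s]) auto
    then show "AE t in lborel. (\<lambda>i. F (s i) t) \<longlonglongrightarrow> F z t" by simp
  qed (use meas w le in auto)
  then show "((\<lambda>z. \<integral>t. F z t \<partial>lborel) \<circ> s) \<longlonglongrightarrow> (\<integral>t. F z t \<partial>lborel)"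
    by (simp add: o_def)
qed

lemma
  fixes F :: "'a::euclidean_space \<Rightarrow> real \<Rightarrow> 'b::{real_normed_field, banach, second_countable_topology}"
  assumes int: "\<And>b. b \<in> Basis \<Longrightarrow> integrable lborel (F b)"
  shows integrable_prod_Basis: "integrable lborel (\<lambda>x. \<Prod>b\<in>Basis. F b (x \<bullet> b))"
    and integral_prod_Basis:
      "(\<integral>x. (\<Prod>b\<in>Basis. F b (x \<bullet> b)) \<partial>lborel) = (\<Prod>b\<in>Basis. \<integral>u. F b u \<partial>lborel)"
proof -
  interpret product_sigma_finite "\<lambda>_::'a. lborel :: real measure" ..
  have [measurable]: "F b \<in> borel_measurable borel" if "b \<in> Basis" for b
    using borel_measurable_integrable[OF int[OF that]] by simp
  have *: "(\<Prod>b\<in>Basis. F b ((\<Sum>b\<in>Basis. f b *\<^sub>R b) \<bullet> b)) = (\<Prod>b\<in>Basis. F b (f b))" for f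
    by (intro prod.cong refl) (simp add: inner_sum_left inner_Basis if_distrib cong: if_cong)
  have m: "(\<lambda>f. \<Sum>b\<in>Basis. f b *\<^sub>R b) \<in> (\<Pi>\<^sub>M b\<in>(Basis::'a set). (lborel::real measure)) \<rightarrow>\<^sub>M (borel :: 'a measure)"
    by measurable
  have m2: "(\<lambda>x::'a. \<Prod>b\<in>Basis. F b (x \<bullet> b)) \<in> borel_measurable borel"
    by measurable
  show "integrable lborel (\<lambda>x::'a. \<Prod>b\<in>Basis. F b (x \<bullet> b))"
    unfolding lborel_eq[where 'a='a]
    by (subst integrable_distr_eq[OF m m2]) (simp only: *, rule product_integrable_prod[OF finite_Basis int])
  show "(\<integral>x. (\<Prod>b\<in>Basis. F b (x \<bullet> b)) \<partial>lborel) = (\<Prod>b\<in>Basis. \<integral>u. F b u \<partial>lborel)"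
    unfolding lborel_eq[where 'a='a]
    by (subst integral_distr[OF m m2]) (simp only: *, rule product_integral_prod[OF finite_Basis int])
qed

text \<open>
  Comparison with the derivative of \<open>arctan\<close>: the quadratic Taylor polynomial bounds \<open>exp (k \<bar>x\<bar>)\<close>
  below by \<open>1\<close> and by \<open>k\<^sup>2 x\<^sup>2 / 2\<close>, hence by a multiple of \<open>1 + x\<^sup>2\<close>.
\<close>

lemma integrable_exp_neg_abs:
  assumes k: "k > 0" shows "integrable lborel (\<lambda>x::real. exp (- k * \<bar>x\<bar>))"
proof (rule Bochner_Integration.integrable_bound)
  show "integrable lborel (\<lambda>x::real. (1 + 2 / k\<^sup>2) * inverse (1 + x\<^sup>2))"
    using integrable_inverse_1_plus_square by (simp add: set_integrable_def einterval_def)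
  have "exp (- k * \<bar>x\<bar>) \<le> (1 + 2 / k\<^sup>2) * inverse (1 + x\<^sup>2)" for x :: real
  proof -
    have 0: "1 + k * \<bar>x\<bar> + (k * \<bar>x\<bar>)\<^sup>2 / 2 \<le> exp (k * \<bar>x\<bar>)"
      using k by (intro exp_lower_Taylor_quadratic) auto
    have "0 \<le> k * \<bar>x\<bar>" using k by simp
    with 0 have 1: "1 \<le> exp (k * \<bar>x\<bar>)" and 2: "k\<^sup>2 * x\<^sup>2 / 2 \<le> exp (k * \<bar>x\<bar>)"
      by (simp_all add: power_mult_distrib)
    from 2 k have "x\<^sup>2 \<le> 2 / k\<^sup>2 * exp (k * \<bar>x\<bar>)" by (simp add: field_simps)
    with 1 have "1 + x\<^sup>2 \<le> 1 * exp (k * \<bar>x\<bar>) + 2 / k\<^sup>2 * exp (k * \<bar>x\<bar>)"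
      by (intro add_mono) simp_all
    then have "1 + x\<^sup>2 \<le> (1 + 2 / k\<^sup>2) * exp (k * \<bar>x\<bar>)" by (simp only: distrib_right)
    moreover have "0 < 1 + x\<^sup>2" by (simp add: add_pos_nonneg)
    ultimately show ?thesis
      by (simp add: exp_minus inverse_eq_divide pos_divide_le_eq pos_le_divide_eq mult_ac)
  qed
  then show "AE x in lborel. norm (exp (- k * \<bar>x\<bar>)) \<le> norm ((1 + 2 / k\<^sup>2) * inverse (1 + x\<^sup>2))"
    by (intro AE_I2) (use order_trans[OF _ abs_ge_self] in auto)
qed simp

text \<open>
  The norm is at least the average of the absolute values of the coordinates, so the exponential is
  dominated by a product of one-dimensional ones.
\<close>

lemma integrable_exp_neg_norm:
  assumes h: "h > 0" shows "integrable lborel (\<lambda>x::'a::euclidean_space. exp (- h * norm x))"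
proof (rule Bochner_Integration.integrable_bound)
  let ?k = "h / DIM('a)"
  have k: "?k > 0" using h by simp
  show "integrable lborel (\<lambda>x::'a. \<Prod>b\<in>Basis. exp (- ?k * \<bar>x \<bullet> b\<bar>))"
    using integrable_exp_neg_abs[OF k] by (rule integrable_prod_Basis)
  have "exp (- h * norm x) \<le> (\<Prod>b\<in>Basis. exp (- ?k * \<bar>x \<bullet> b\<bar>))" for x :: 'a
  proof -
    have "(\<Sum>b\<in>Basis. \<bar>x \<bullet> b\<bar>) \<le> DIM('a) * norm x"
      by (rule sum_bounded_above) (rule Basis_le_norm)
    then have "?k * (\<Sum>b\<in>Basis. \<bar>x \<bullet> b\<bar>) \<le> ?k * (DIM('a) * norm x)"
      using k by (intro mult_left_mono) auto
    then have "- h * norm x \<le> (\<Sum>b\<in>Basis. - ?k * \<bar>x \<bullet> b\<bar>)"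
      by (simp add: sum_distrib_left sum_negf)
    then show ?thesis by (simp only: exp_sum[OF finite_Basis, symmetric] exp_le_cancel_iff)
  qed
  note le = this
  show "AE x in lborel. norm (exp (- h * norm x)) \<le> norm (\<Prod>b\<in>(Basis::'a set). exp (- ?k * \<bar>x \<bullet> b\<bar>))"
    unfolding real_norm_def abs_exp_cancel abs_prod by (intro AE_I2 le)
qed simp

section \<open>Fourier inversion\<close>

lemma cis_sum: "finite A \<Longrightarrow> cis (sum f A) = (\<Prod>a\<in>A. cis (f a))"
  by (induction A rule: finite_induct) (simp_all add: cis_mult[symmetric])

lemma fourier_cis: "fourier f \<omega> = (\<integral>t. f t * cis (- (2 * pi * (t \<bullet> \<omega>))) \<partial>lborel)"
  unfolding fourier_def by (simp add: cis_conv_exp mult_ac)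

lemma borel_measurable_cis [measurable]: "cis \<in> borel_measurable borel"
  by (intro borel_measurable_continuous_onI continuous_intros)

lemma borel_measurable_cnj [measurable]: "cnj \<in> borel_measurable borel"
  by (intro borel_measurable_continuous_onI continuous_intros)

lemma integrable_exp_neg_norm_sq:
  "integrable lborel (\<lambda>x::'a::euclidean_space. exp (- pi * (norm x)\<^sup>2))"
proof (rule Bochner_Integration.integrable_bound)
  show "integrable lborel (\<lambda>x::'a. exp 1 * exp (- 1 * norm x))"
    by (intro integrable_mult_right integrable_exp_neg_norm) simp
  have "- pi * (norm x)\<^sup>2 \<le> 1 + - 1 * norm x" for x :: 'a
  proof -
    have "0 \<le> (norm x - 1)\<^sup>2" by simp
    moreover have "1 * (norm x)\<^sup>2 \<le> pi * (norm x)\<^sup>2"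
      using pi_gt3 by (intro mult_right_mono) auto
    moreover have "(norm x - 1)\<^sup>2 = (norm x)\<^sup>2 - 2 * norm x + 1"
      by (simp add: power2_eq_square algebra_simps)
    ultimately show ?thesis using norm_ge_zero[of x] zero_le_power2[of "norm x"] by linarith
  qed
  then show "AE x in lborel. norm (exp (- pi * (norm x)\<^sup>2)) \<le> norm (exp 1 * exp (- 1 * norm (x::'a)))"
    by (intro AE_I2) (simp add: exp_add[symmetric] del: exp_add)
qed simp

text \<open>
  This is the characteristic function of the standard normal distribution, rescaled by \<open>sqrt (2 \<pi>)\<close>.
\<close>

lemma gaussian_fourier_real:
  "(\<integral>u. cis (2 * pi * (y * u)) * of_real (exp (- pi * u\<^sup>2)) \<partial>lborel) = of_real (exp (- pi * y\<^sup>2))"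
proof -
  let ?s = "sqrt (2 * pi)"
  have s: "?s > 0" "?s * ?s = 2 * pi" by simp_all
  have "of_real (exp (- ((?s * y)\<^sup>2) / 2)) = char std_normal_distribution (?s * y)"
    by (simp add: char_std_normal_distribution)
  also have "\<dots> = (\<integral>x. std_normal_density x *\<^sub>R cis (?s * y * x) \<partial>lborel)"
    unfolding char_def by (subst integral_density) (auto simp: cis_conv_exp)
  also have "\<dots> = ?s *\<^sub>R (\<integral>u. std_normal_density (?s * u) *\<^sub>R cis (?s * y * (?s * u)) \<partial>lborel)"
    using s(1) by (subst lborel_integral_real_affine[where c="?s" and t=0]) auto
  also have "\<dots> = (\<integral>u. ?s *\<^sub>R (std_normal_density (?s * u) *\<^sub>R cis (?s * y * (?s * u))) \<partial>lborel)"
    by (rule integral_scaleR_right[symmetric])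
  also have "\<dots> = (\<integral>u. cis (2 * pi * (y * u)) * of_real (exp (- pi * u\<^sup>2)) \<partial>lborel)"
  proof (intro Bochner_Integration.integral_cong refl)
    fix u
    have "?s * y * (?s * u) = 2 * pi * (y * u)" using s(2) by (metis mult.assoc mult.left_commute)
    moreover have "?s * std_normal_density (?s * u) = exp (- pi * u\<^sup>2)"
      by (simp add: std_normal_density_def power_mult_distrib)
    ultimately show "?s *\<^sub>R (std_normal_density (?s * u) *\<^sub>R cis (?s * y * (?s * u)))
        = cis (2 * pi * (y * u)) * of_real (exp (- pi * u\<^sup>2))"
      by (simp only: scaleR_scaleR) (simp only: scaleR_conv_of_real mult.commute)
  qed
  finally show ?thesis by (simp add: power_mult_distrib)
qed

lemma gaussian_fourier:
  fixes y :: "'a::euclidean_space"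
  shows "(\<integral>u. cis (2 * pi * (y \<bullet> u)) * of_real (exp (- pi * (norm u)\<^sup>2)) \<partial>lborel)
    = of_real (exp (- pi * (norm y)\<^sup>2))"
proof -
  have sq: "- pi * (norm v)\<^sup>2 = (\<Sum>b\<in>Basis. - pi * (v \<bullet> b)\<^sup>2)" for v :: 'a
    unfolding power2_norm_eq_inner by (subst euclidean_inner) (simp add: sum_distrib_left power2_eq_square)
  let ?F = "\<lambda>b v. cis (2 * pi * ((y \<bullet> b) * v)) * complex_of_real (exp (- pi * v\<^sup>2))"
  have int: "integrable lborel (?F b)" for b
    by (rule Bochner_Integration.integrable_bound[OF integrable_exp_neg_norm_sq[where 'a=real]])
       (auto simp: norm_mult)
  have "cis (2 * pi * (y \<bullet> u)) * of_real (exp (- pi * (norm u)\<^sup>2)) = (\<Prod>b\<in>Basis. ?F b (u \<bullet> b))" for u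
    unfolding sq by (simp add: euclidean_inner[of y u] sum_distrib_left cis_sum exp_sum prod.distrib)
  then have "(\<integral>u. cis (2 * pi * (y \<bullet> u)) * of_real (exp (- pi * (norm u)\<^sup>2)) \<partial>lborel)
      = (\<Prod>b\<in>Basis. \<integral>v. ?F b v \<partial>lborel)"
    using integral_prod_Basis[of ?F, OF int] by simp
  also have "\<dots> = (\<Prod>b\<in>Basis. of_real (exp (- pi * (y \<bullet> b)\<^sup>2)))"
    by (simp only: gaussian_fourier_real)
  also have "\<dots> = of_real (exp (- pi * (norm y)\<^sup>2))"
    unfolding sq by (simp add: exp_sum)
  finally show ?thesis .
qed

lemma continuous_on_fourier:
  assumes f: "integrable lborel f" shows "continuous_on UNIV (fourier f)"
  unfolding fourier_cis[abs_def]
proof (rule continuous_on_integral_dominated)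
  have [measurable]: "f \<in> borel_measurable borel"
    using borel_measurable_integrable[OF f] by simp
  show "integrable lborel (\<lambda>t. norm (f t))" using f by simp
  show "(\<lambda>t. f t * cis (- (2 * pi * (t \<bullet> z)))) \<in> borel_measurable borel" for z by measurable
  show "continuous_on UNIV (\<lambda>z. f t * cis (- (2 * pi * (t \<bullet> z))))" for t
    by (intro continuous_intros)
  show "norm (f t * cis (- (2 * pi * (t \<bullet> z)))) \<le> norm (f t)" for t z by (simp add: norm_mult)
qed

text \<open>
  Gaussian summation of the inversion integral: a Gaussian factor of width \<open>1/e\<close> on the frequency
  side makes the double integral absolutely convergent.  After the substitution
  \<open>t = x + e s\<close> the frequency integral is the transform of a Gaussian, so what remains is an
  average of \<open>f\<close> over a Gaussian of width \<open>e\<close> around \<open>x\<close>.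
\<close>

lemma fourier_gaussian_average:
  fixes f :: "'a::euclidean_space \<Rightarrow> complex"
  assumes f: "integrable lborel f" and e: "e > 0"
  shows "(\<integral>\<omega>. fourier f \<omega> * cis (2 * pi * (x \<bullet> \<omega>)) * of_real (exp (- pi * (norm (e *\<^sub>R \<omega>))\<^sup>2)) \<partial>lborel)
    = (\<integral>s. f (x + e *\<^sub>R s) * of_real (exp (- pi * (norm s)\<^sup>2)) \<partial>lborel)"
proof -
  have [measurable]: "f \<in> borel_measurable borel"
    using borel_measurable_integrable[OF f] by simp
  let ?G = "\<lambda>u::'a. complex_of_real (exp (- pi * (norm u)\<^sup>2))"
  let ?N = "\<bar>e\<bar> ^ DIM('a)"
  let ?H = "\<lambda>\<omega> s. ?N *\<^sub>R (f (x + e *\<^sub>R s) * cis (2 * pi * (- s \<bullet> (e *\<^sub>R \<omega>))) * ?G (e *\<^sub>R \<omega>))"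
  have fs: "integrable lborel (\<lambda>s. f (x + e *\<^sub>R s))"
    using f e by (intro integrable_lborel_affine) auto
  have G: "integrable lborel (\<lambda>u::'a. exp (- pi * (norm (e *\<^sub>R u))\<^sup>2))"
    using integrable_lborel_affine[OF integrable_exp_neg_norm_sq, of e "0::'a"] e by simp
  have H: "integrable lborel (\<lambda>(\<omega>, s). ?H \<omega> s)"
  proof (rule integrable_lborel_pair_bound[OF _ integrable_mult_right[OF G, of ?N] integrable_norm[OF fs]])
    show "(\<lambda>(\<omega>, s). ?H \<omega> s) \<in> borel_measurable (borel \<Otimes>\<^sub>M borel)"
      by measurable
    show "norm (case (\<omega>, s) of (\<omega>, s) \<Rightarrow> ?H \<omega> s)
        \<le> ?N * exp (- pi * (norm (e *\<^sub>R \<omega>))\<^sup>2) * norm (f (x + e *\<^sub>R s))" for \<omega> s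
      using e by (simp add: norm_mult)
  qed
  have "(\<integral>\<omega>. fourier f \<omega> * cis (2 * pi * (x \<bullet> \<omega>)) * ?G (e *\<^sub>R \<omega>) \<partial>lborel)
      = (\<integral>\<omega>. (\<integral>s. ?H \<omega> s \<partial>lborel) \<partial>lborel)"
  proof (intro Bochner_Integration.integral_cong refl)
    fix \<omega>
    have "fourier f \<omega> = ?N *\<^sub>R (\<integral>s. f (x + e *\<^sub>R s) * cis (- (2 * pi * ((x + e *\<^sub>R s) \<bullet> \<omega>))) \<partial>lborel)"
      unfolding fourier_cis using e by (subst integral_lborel_affine[where t=x and c=e]) auto
    also have "\<dots> * (cis (2 * pi * (x \<bullet> \<omega>)) * ?G (e *\<^sub>R \<omega>))
       = ?N *\<^sub>R (\<integral>s. f (x + e *\<^sub>R s) * cis (- (2 * pi * ((x + e *\<^sub>R s) \<bullet> \<omega>)))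
             * (cis (2 * pi * (x \<bullet> \<omega>)) * ?G (e *\<^sub>R \<omega>)) \<partial>lborel)"
      by (simp only: mult_scaleR_left integral_mult_left_zero)
    also have "\<dots> = (\<integral>s. ?H \<omega> s \<partial>lborel)"
      unfolding integral_scaleR_right[symmetric]
    proof (intro Bochner_Integration.integral_cong refl, goal_cases)
      case (1 s)
      have "cis (2 * pi * (- s \<bullet> (e *\<^sub>R \<omega>)))
          = cis (- (2 * pi * ((x + e *\<^sub>R s) \<bullet> \<omega>))) * cis (2 * pi * (x \<bullet> \<omega>))"
        by (simp add: cis_mult inner_add_left algebra_simps)
      then show ?case by (simp only: mult.assoc)
    qed
    finally show "fourier f \<omega> * cis (2 * pi * (x \<bullet> \<omega>)) * ?G (e *\<^sub>R \<omega>) = (\<integral>s. ?H \<omega> s \<partial>lborel)"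
      by (simp only: mult.assoc)
  qed
  also have "\<dots> = (\<integral>s. (\<integral>\<omega>. ?H \<omega> s \<partial>lborel) \<partial>lborel)"
    using integral_lborel_swap[OF H] by simp
  also have "\<dots> = (\<integral>s. f (x + e *\<^sub>R s) * ?G s \<partial>lborel)"
  proof (intro Bochner_Integration.integral_cong refl)
    fix s
    have "(\<integral>\<omega>. ?H \<omega> s \<partial>lborel)
        = (\<integral>\<omega>. ?N *\<^sub>R (f (x + e *\<^sub>R s) * (cis (2 * pi * (- s \<bullet> (e *\<^sub>R \<omega>))) * ?G (e *\<^sub>R \<omega>))) \<partial>lborel)"
      by (simp only: mult.assoc)
    also have "\<dots> = f (x + e *\<^sub>R s)
        * (?N *\<^sub>R (\<integral>\<omega>. cis (2 * pi * (- s \<bullet> (e *\<^sub>R \<omega>))) * ?G (e *\<^sub>R \<omega>) \<partial>lborel))"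
      by (simp only: integral_scaleR_right integral_mult_right_zero mult_scaleR_right)
    also have "?N *\<^sub>R (\<integral>\<omega>. cis (2 * pi * (- s \<bullet> (e *\<^sub>R \<omega>))) * ?G (e *\<^sub>R \<omega>) \<partial>lborel)
        = (\<integral>u. cis (2 * pi * (- s \<bullet> u)) * ?G u \<partial>lborel)"
      using e by (subst integral_lborel_affine[where t=0 and c=e]) auto
    also have "\<dots> = ?G s"
      using gaussian_fourier[of "- s"] by simp
    finally show "(\<integral>\<omega>. ?H \<omega> s \<partial>lborel) = f (x + e *\<^sub>R s) * ?G s" .
  qed
  finally show ?thesis .
qed

text \<open>
  Let \<open>e\<close> tend to \<open>0\<close> in \<open>fourier_gaussian_average\<close>; dominated convergence applies on both sides,
  by integrability of the Fourier transform on the left and by boundedness of \<open>f\<close> on the right.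
\<close>

lemma fourier_inversion:
  fixes f :: "'a::euclidean_space \<Rightarrow> complex"
  assumes cont: "continuous_on UNIV f" and B: "\<And>x. norm (f x) \<le> B"
    and f: "integrable lborel f" and f': "integrable lborel (fourier f)"
  shows "(\<integral>\<omega>. fourier f \<omega> * cis (2 * pi * (x \<bullet> \<omega>)) \<partial>lborel) = f x"
proof -
  let ?G = "\<lambda>u::'a. complex_of_real (exp (- pi * (norm u)\<^sup>2))"
  let ?e = "\<lambda>n. inverse (real (Suc n))"
  have [measurable]: "f \<in> borel_measurable borel" "fourier f \<in> borel_measurable borel"
    using borel_measurable_integrable[OF f] borel_measurable_integrable[OF f'] by simp_all
  have e: "?e \<longlonglongrightarrow> 0" by (rule LIMSEQ_inverse_real_of_nat)
  have L: "(\<lambda>n. \<integral>\<omega>. fourier f \<omega> * cis (2 * pi * (x \<bullet> \<omega>)) * ?G (?e n *\<^sub>R \<omega>) \<partial>lborel)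
      \<longlonglongrightarrow> (\<integral>\<omega>. fourier f \<omega> * cis (2 * pi * (x \<bullet> \<omega>)) \<partial>lborel)"
  proof (rule integral_dominated_convergence[where w="\<lambda>\<omega>. norm (fourier f \<omega>)"])
    have "(\<lambda>n. fourier f \<omega> * cis (2 * pi * (x \<bullet> \<omega>)) * ?G (?e n *\<^sub>R \<omega>))
       \<longlonglongrightarrow> fourier f \<omega> * cis (2 * pi * (x \<bullet> \<omega>)) * ?G (0 *\<^sub>R \<omega>)" for \<omega>
      by (intro tendsto_intros e)
    then show "AE \<omega> in lborel. (\<lambda>n. fourier f \<omega> * cis (2 * pi * (x \<bullet> \<omega>)) * ?G (?e n *\<^sub>R \<omega>))
       \<longlonglongrightarrow> fourier f \<omega> * cis (2 * pi * (x \<bullet> \<omega>))" by simp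
    show "AE \<omega> in lborel. norm (fourier f \<omega> * cis (2 * pi * (x \<bullet> \<omega>)) * ?G (?e n *\<^sub>R \<omega>))
        \<le> norm (fourier f \<omega>)" for n
      by (auto simp: norm_mult intro!: mult_left_le)
  qed (use f' in auto)
  have "(\<lambda>n. \<integral>s. f (x + ?e n *\<^sub>R s) * ?G s \<partial>lborel) \<longlonglongrightarrow> (\<integral>s. f x * ?G s \<partial>lborel)"
  proof (rule integral_dominated_convergence[where w="\<lambda>s. B * exp (- pi * (norm s)\<^sup>2)"])
    have "(\<lambda>n. f (x + ?e n *\<^sub>R s) * ?G s) \<longlonglongrightarrow> f (x + 0 *\<^sub>R s) * ?G s" for s
      by (intro tendsto_intros e continuous_on_tendsto_compose[OF cont]) auto
    then show "AE s in lborel. (\<lambda>n. f (x + ?e n *\<^sub>R s) * ?G s) \<longlonglongrightarrow> f x * ?G s" by simp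
    show "integrable lborel (\<lambda>s::'a. B * exp (- pi * (norm s)\<^sup>2))"
      by (intro integrable_mult_right integrable_exp_neg_norm_sq)
    show "AE s in lborel. norm (f (x + ?e n *\<^sub>R s) * ?G s) \<le> B * exp (- pi * (norm s)\<^sup>2)" for n
      by (auto simp: norm_mult intro!: mult_right_mono B)
  qed auto
  then have R: "(\<lambda>n. \<integral>\<omega>. fourier f \<omega> * cis (2 * pi * (x \<bullet> \<omega>)) * ?G (?e n *\<^sub>R \<omega>) \<partial>lborel)
      \<longlonglongrightarrow> (\<integral>s. f x * ?G s \<partial>lborel)"
    by (subst fourier_gaussian_average[OF f]) simp_all
  have "(\<integral>\<omega>. fourier f \<omega> * cis (2 * pi * (x \<bullet> \<omega>)) \<partial>lborel) = (\<integral>s. f x * ?G s \<partial>lborel)"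
    using L R by (rule LIMSEQ_unique)
  also have "\<dots> = f x"
    using gaussian_fourier[of "0::'a"] by simp
  finally show ?thesis .
qed

lemma fourier_parseval:
  fixes f g :: "'a::euclidean_space \<Rightarrow> complex"
  assumes cont: "continuous_on UNIV f" and B: "\<And>x. norm (f x) \<le> B"
    and f: "integrable lborel f" and f': "integrable lborel (fourier f)"
    and g: "integrable lborel g"
  shows "(\<integral>\<omega>. fourier f \<omega> * cnj (fourier g \<omega>) \<partial>lborel) = (\<integral>t. f t * cnj (g t) \<partial>lborel)"
proof -
  have [measurable]: "g \<in> borel_measurable borel" "fourier f \<in> borel_measurable borel"
    using borel_measurable_integrable[OF g] borel_measurable_integrable[OF f'] by simp_all
  let ?H = "\<lambda>\<omega> t. fourier f \<omega> * cis (2 * pi * (t \<bullet> \<omega>)) * cnj (g t)"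
  have H: "integrable lborel (\<lambda>(\<omega>, t). ?H \<omega> t)"
  proof (rule integrable_lborel_pair_bound[OF _ integrable_norm[OF f'] integrable_norm[OF g]])
    show "(\<lambda>(\<omega>, t). ?H \<omega> t) \<in> borel_measurable (borel \<Otimes>\<^sub>M borel)"
      by measurable
    show "norm (case (\<omega>, t) of (\<omega>, t) \<Rightarrow> ?H \<omega> t) \<le> norm (fourier f \<omega>) * norm (g t)" for \<omega> t
      by (simp add: norm_mult)
  qed
  have "(\<integral>\<omega>. fourier f \<omega> * cnj (fourier g \<omega>) \<partial>lborel) = (\<integral>\<omega>. (\<integral>t. ?H \<omega> t \<partial>lborel) \<partial>lborel)"
    unfolding fourier_cis[of g] Bochner_Integration.integral_cnj[symmetric] integral_mult_right_zero[symmetric]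
    by (simp only: complex_cnj_mult cis_cnj minus_minus mult_ac)
  also have "\<dots> = (\<integral>t. (\<integral>\<omega>. ?H \<omega> t \<partial>lborel) \<partial>lborel)"
    using integral_lborel_swap[OF H] by simp
  also have "\<dots> = (\<integral>t. f t * cnj (g t) \<partial>lborel)"
    by (simp add: fourier_inversion[OF cont B f f'])
  finally show ?thesis .
qed

section \<open>Exponential decay\<close>

definition exp_decay :: "('a::real_normed_vector \<Rightarrow> complex) \<Rightarrow> bool" where
  "exp_decay f \<longleftrightarrow> (\<forall>h>0. \<exists>C\<ge>0. \<forall>x. norm (f x) \<le> C * exp (- h * norm x))"

lemma exp_decayD:
  assumes "exp_decay f" "h > 0"
  obtains C where "C \<ge> 0" "\<And>x. norm (f x) \<le> C * exp (- h * norm x)"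
  using assms unfolding exp_decay_def by blast

lemma exp_decayI:
  assumes "\<And>h. h > 0 \<Longrightarrow> \<exists>C\<ge>0. \<forall>x. norm (f x) \<le> C * exp (- h * norm x)"
  shows "exp_decay f"
  using assms unfolding exp_decay_def by blast

lemma exp_decay_bounded:
  assumes "exp_decay f" obtains B where "\<And>x. norm (f x) \<le> B"
proof -
  obtain C where C: "C \<ge> 0" "\<And>x. norm (f x) \<le> C * exp (- 1 * norm x)"
    using exp_decayD[OF assms, of 1] by auto
  have "norm (f x) \<le> C" for x
    by (rule order.trans[OF C(2)]) (use C(1) in \<open>simp add: mult_left_le\<close>)
  then show ?thesis by (rule that)
qed

lemma exp_decay_integrable:
  fixes f :: "'a::euclidean_space \<Rightarrow> complex"
  assumes d: "exp_decay f" and m: "f \<in> borel_measurable borel"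
  shows "integrable lborel f"
proof -
  obtain C where C: "C \<ge> 0" "\<And>x. norm (f x) \<le> C * exp (- 1 * norm x)"
    using exp_decayD[OF d, of 1] by auto
  have "integrable lborel (\<lambda>x::'a. C * exp (- 1 * norm x))"
    by (intro integrable_mult_right integrable_exp_neg_norm) simp
  then show ?thesis
    by (rule Bochner_Integration.integrable_bound)
       (use m in simp, intro AE_I2, rule order.trans[OF C(2)], simp)
qed

text \<open>
  Decay survives affine substitution because \<open>\<bar>c\<bar> \<bar>x\<bar> \<le> \<bar>p + c x\<bar> + \<bar>p\<bar>\<close>.
\<close>

lemma exp_decay_affine:
  assumes d: "exp_decay f" and c: "c \<noteq> 0"
  shows "exp_decay (\<lambda>x. f (p + c *\<^sub>R x))"
proof (rule exp_decayI)
  fix h :: real assume h: "h > 0"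
  let ?k = "h / \<bar>c\<bar>"
  have k: "?k > 0" using h c by simp
  obtain C where C: "C \<ge> 0" "\<And>x. norm (f x) \<le> C * exp (- ?k * norm x)"
    using exp_decayD[OF d k] by blast
  show "\<exists>C\<ge>0. \<forall>x. norm (f (p + c *\<^sub>R x)) \<le> C * exp (- h * norm x)"
  proof (intro exI[of _ "C * exp (?k * norm p)"] conjI allI)
    fix x
    have "\<bar>c\<bar> * norm x \<le> norm (p + c *\<^sub>R x) + norm p"
      using norm_triangle_ineq4[of "p + c *\<^sub>R x" p] by simp
    then have "?k * (\<bar>c\<bar> * norm x) \<le> ?k * (norm (p + c *\<^sub>R x) + norm p)"
      by (rule mult_left_mono[OF _ less_imp_le[OF k]])
    moreover have "?k * (\<bar>c\<bar> * norm x) = h * norm x" using c by simp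
    ultimately have "- ?k * norm (p + c *\<^sub>R x) \<le> ?k * norm p + - h * norm x"
      unfolding distrib_left mult_minus_left by linarith
    then have "exp (- ?k * norm (p + c *\<^sub>R x)) \<le> exp (?k * norm p) * exp (- h * norm x)"
      by (simp only: exp_add[symmetric] exp_le_cancel_iff)
    then have "C * exp (- ?k * norm (p + c *\<^sub>R x)) \<le> C * (exp (?k * norm p) * exp (- h * norm x))"
      using C(1) by (rule mult_left_mono)
    then show "norm (f (p + c *\<^sub>R x)) \<le> C * exp (?k * norm p) * exp (- h * norm x)"
      using C(2)[of "p + c *\<^sub>R x"] by (simp only: mult.assoc)
  qed (use C(1) in simp)
qed

lemma exp_decay_cong_norm:
  assumes "exp_decay f" "\<And>x. norm (g x) = norm (f x)" shows "exp_decay g"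
  using assms unfolding exp_decay_def by simp

lemma exp_decay_cmult:
  assumes d: "exp_decay f" shows "exp_decay (\<lambda>x. c * f x)"
proof (rule exp_decayI)
  fix h :: real assume "h > 0"
  then obtain C where C: "C \<ge> 0" "\<And>x. norm (f x) \<le> C * exp (- h * norm x)"
    using exp_decayD[OF d] by blast
  show "\<exists>C\<ge>0. \<forall>x. norm (c * f x) \<le> C * exp (- h * norm x)"
    by (intro exI[of _ "norm c * C"])
       (use C in \<open>auto simp: norm_mult mult.assoc intro!: mult_left_mono\<close>)
qed

lemma exp_decay_add:
  assumes d: "exp_decay f" "exp_decay g" shows "exp_decay (\<lambda>x. f x + g x)"
proof (rule exp_decayI)
  fix h :: real assume h: "h > 0"
  obtain C where C: "C \<ge> 0" "\<And>x. norm (f x) \<le> C * exp (- h * norm x)"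
    using exp_decayD[OF d(1) h] by blast
  obtain D where D: "D \<ge> 0" "\<And>x. norm (g x) \<le> D * exp (- h * norm x)"
    using exp_decayD[OF d(2) h] by blast
  show "\<exists>C\<ge>0. \<forall>x. norm (f x + g x) \<le> C * exp (- h * norm x)"
    by (intro exI[of _ "C + D"])
       (use C D in \<open>auto simp: distrib_right intro!: order.trans[OF norm_triangle_ineq] add_mono\<close>)
qed

lemma exp_decay_mult:
  assumes d: "exp_decay f" "exp_decay g" shows "exp_decay (\<lambda>x. f x * g x)"
proof (rule exp_decayI)
  fix h :: real assume h: "h > 0"
  obtain C where C: "C \<ge> 0" "\<And>x. norm (f x) \<le> C * exp (- h * norm x)"
    using exp_decayD[OF d(1) h] by blast
  obtain B where B: "\<And>x. norm (g x) \<le> B" using exp_decay_bounded[OF d(2)] by blast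
  have "0 \<le> B" using B[of 0] norm_ge_zero order.trans by blast
  then have "norm (f x * g x) \<le> C * exp (- h * norm x) * B" for x
    unfolding norm_mult using B C by (intro mult_mono) auto
  then show "\<exists>C\<ge>0. \<forall>x. norm (f x * g x) \<le> C * exp (- h * norm x)"
    using C(1) \<open>0 \<le> B\<close> by (intro exI[of _ "C * B"]) (simp add: mult_ac)
qed

text \<open>
  Use both bounds with rate \<open>2h\<close>: the better one has the exponent
  \<open>- 2h max \<bar>x\<bar> \<bar>y\<bar> \<le> - h \<bar>(x, y)\<bar>\<close>.
\<close>

lemma exp_decay_pair:
  fixes F :: "'a::real_normed_vector \<times> 'b::real_normed_vector \<Rightarrow> complex"
  assumes x: "\<And>h. h > 0 \<Longrightarrow> \<exists>C\<ge>0. \<forall>x y. norm (F (x, y)) \<le> C * exp (- h * norm x)"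
    and y: "\<And>h. h > 0 \<Longrightarrow> \<exists>C\<ge>0. \<forall>x y. norm (F (x, y)) \<le> C * exp (- h * norm y)"
  shows "exp_decay F"
proof (rule exp_decayI)
  fix h :: real assume h: "h > 0"
  then have h2: "2 * h > 0" by simp
  obtain C where C: "C \<ge> 0" "\<And>x y. norm (F (x, y)) \<le> C * exp (- (2 * h) * norm x)"
    using x[OF h2] by blast
  obtain D where D: "D \<ge> 0" "\<And>x y. norm (F (x, y)) \<le> D * exp (- (2 * h) * norm y)"
    using y[OF h2] by blast
  show "\<exists>C\<ge>0. \<forall>z. norm (F z) \<le> C * exp (- h * norm z)"
  proof (intro exI[of _ "C + D"] conjI allI)
    fix z :: "'a \<times> 'b" obtain x y where z: "z = (x, y)" by (cases z)
    have n: "norm z \<le> norm x + norm y" unfolding z by (rule norm_Pair_le)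
    have "norm (F z) \<le> C * exp (- h * norm z) \<or> norm (F z) \<le> D * exp (- h * norm z)"
    proof (cases "norm y \<le> norm x")
      case True
      then have "h * norm z \<le> h * (2 * norm x)" using n h by (intro mult_left_mono) auto
      then have "exp (- (2 * h) * norm x) \<le> exp (- h * norm z)" by simp
      then have "C * exp (- (2 * h) * norm x) \<le> C * exp (- h * norm z)"
        using C(1) by (rule mult_left_mono)
      then show ?thesis using C(2)[of x y] unfolding z by linarith
    next
      case False
      then have "h * norm z \<le> h * (2 * norm y)" using n h by (intro mult_left_mono) auto
      then have "exp (- (2 * h) * norm y) \<le> exp (- h * norm z)" by simp
      then have "D * exp (- (2 * h) * norm y) \<le> D * exp (- h * norm z)"
        using D(1) by (rule mult_left_mono)
      then show ?thesis using D(2)[of x y] unfolding z by linarith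
    qed
    moreover have "0 \<le> C * exp (- h * norm z)" "0 \<le> D * exp (- h * norm z)" using C(1) D(1) by simp_all
    ultimately show "norm (F z) \<le> (C + D) * exp (- h * norm z)"
      unfolding distrib_right by linarith
  qed (use C(1) D(1) in simp)
qed

lemma exp_decay_iff_bounded:
  "exp_decay f \<longleftrightarrow> (\<forall>h>0. bounded (range (\<lambda>x. f x * of_real (exp (h * norm x)))))"
proof -
  have *: "norm (f x * of_real (exp (h * norm x))) \<le> C \<longleftrightarrow> norm (f x) \<le> C * exp (- h * norm x)"
    for x h C
    by (simp add: norm_mult exp_minus pos_le_divide_eq divide_inverse[symmetric])
  have "bounded (range (\<lambda>x. f x * of_real (exp (h * norm x))))
      \<longleftrightarrow> (\<exists>C\<ge>0. \<forall>x. norm (f x) \<le> C * exp (- h * norm x))" for h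
  proof
    assume "bounded (range (\<lambda>x. f x * of_real (exp (h * norm x))))"
    then obtain C where C: "norm (f x * of_real (exp (h * norm x))) \<le> C" for x
      unfolding bounded_iff by blast
    have "0 \<le> C" using order.trans[OF norm_ge_zero C] .
    with C show "\<exists>C\<ge>0. \<forall>x. norm (f x) \<le> C * exp (- h * norm x)" unfolding * by blast
  next
    assume "\<exists>C\<ge>0. \<forall>x. norm (f x) \<le> C * exp (- h * norm x)"
    then show "bounded (range (\<lambda>x. f x * of_real (exp (h * norm x))))"
      unfolding bounded_iff *[symmetric] by blast
  qed
  then show ?thesis unfolding exp_decay_def by simp
qed

section \<open>Closure properties of the Gelfand--Shilov space\<close>

lemma GS_iff: "f \<in> GS \<longleftrightarrow> continuous_on UNIV f \<and> exp_decay f \<and> exp_decay (fourier f)"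
  unfolding GS_def exp_decay_iff_bounded by simp

lemma GS_D:
  assumes "f \<in> GS"
  shows GS_continuous: "continuous_on UNIV f"
    and GS_decay: "exp_decay f"
    and GS_fourier_decay: "exp_decay (fourier f)"
    and GS_measurable: "f \<in> borel_measurable borel"
    and GS_integrable: "integrable lborel f"
    and GS_fourier_continuous: "continuous_on UNIV (fourier f)"
    and GS_fourier_integrable: "integrable lborel (fourier f)"
proof -
  show 1: "continuous_on UNIV f" "exp_decay f" and 2: "exp_decay (fourier f)"
    using assms by (simp_all add: GS_iff)
  from 1 show 3: "f \<in> borel_measurable borel" by (intro borel_measurable_continuous_onI)
  from 1 3 show 4: "integrable lborel f" by (intro exp_decay_integrable)
  then show 5: "continuous_on UNIV (fourier f)" by (rule continuous_on_fourier)
  then have "fourier f \<in> borel_measurable borel" by (intro borel_measurable_continuous_onI)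
  with 2 show "integrable lborel (fourier f)" by (intro exp_decay_integrable)
qed

lemma GS_fourier_inversion:
  assumes f: "f \<in> GS"
  shows "(\<integral>\<omega>. fourier f \<omega> * cis (2 * pi * (x \<bullet> \<omega>)) \<partial>lborel) = f x"
proof -
  obtain B where "\<And>x. norm (f x) \<le> B" using exp_decay_bounded[OF GS_decay[OF f]] by blast
  then show ?thesis
    by (rule fourier_inversion[OF GS_continuous[OF f] _ GS_integrable[OF f] GS_fourier_integrable[OF f]])
qed

lemma fourier_add:
  assumes "integrable lborel f" "integrable lborel g"
  shows "fourier (\<lambda>x. f x + g x) \<omega> = fourier f \<omega> + fourier g \<omega>"
proof -
  have int: "integrable lborel (\<lambda>t. f t * cis (- (2 * pi * (t \<bullet> \<omega>))))" if "integrable lborel f" for f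
  proof -
    have [measurable]: "f \<in> borel_measurable borel" using borel_measurable_integrable[OF that] by simp
    show ?thesis
      by (rule Bochner_Integration.integrable_bound[OF that]) (measurable, simp add: norm_mult)
  qed
  show ?thesis
    unfolding fourier_cis distrib_right using assms
    by (intro Bochner_Integration.integral_add int)
qed

lemma fourier_cmult: "fourier (\<lambda>x. c * f x) \<omega> = c * fourier f \<omega>"
  unfolding fourier_cis mult.assoc by (rule integral_mult_right_zero)

lemma fourier_cnj: "fourier (\<lambda>x. cnj (f x)) \<omega> = cnj (fourier f (- \<omega>))"
  unfolding fourier_cis Bochner_Integration.integral_cnj[symmetric] by (simp add: cis_cnj)

lemma fourier_uminus:
  assumes [measurable]: "f \<in> borel_measurable borel"
  shows "fourier (\<lambda>x. f (- x)) \<omega> = fourier f (- \<omega>)"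
  unfolding fourier_cis
  by (subst (2) integral_lborel_affine[where c="-1" and t=0]) simp_all

lemma fourier_translation:
  assumes [measurable]: "f \<in> borel_measurable borel"
  shows "fourier (translation p f) \<omega> = cis (- (2 * pi * (p \<bullet> \<omega>))) * fourier f \<omega>"
proof -
  have "cis (- (2 * pi * ((p + x) \<bullet> \<omega>))) = cis (- (2 * pi * (p \<bullet> \<omega>))) * cis (- (2 * pi * (x \<bullet> \<omega>)))" for x
    by (simp add: cis_mult inner_add_left algebra_simps)
  then have "fourier (translation p f) \<omega>
      = (\<integral>x. cis (- (2 * pi * (p \<bullet> \<omega>))) * (f x * cis (- (2 * pi * (x \<bullet> \<omega>)))) \<partial>lborel)"
    unfolding fourier_cis translation_def
    by (subst integral_lborel_affine[where c=1 and t=p]) (simp_all add: mult_ac)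
  then show ?thesis unfolding fourier_cis by simp
qed

lemma modulation_cis: "modulation q f t = cis (2 * pi * (q \<bullet> t)) * f t"
  unfolding modulation_def by (simp add: cis_conv_exp mult_ac)

lemma fourier_modulation: "fourier (modulation q f) \<omega> = fourier f (\<omega> - q)"
  unfolding fourier_cis modulation_cis
  by (intro Bochner_Integration.integral_cong refl)
     (simp add: cis_mult inner_diff_right inner_commute algebra_simps)

lemma GS_add: assumes f: "f \<in> GS" and g: "g \<in> GS" shows "(\<lambda>x. f x + g x) \<in> GS"
proof -
  have "fourier (\<lambda>x. f x + g x) = (\<lambda>\<omega>. fourier f \<omega> + fourier g \<omega>)"
    by (intro ext fourier_add GS_integrable f g)
  then show ?thesis
    using f g by (auto simp: GS_iff intro!: exp_decay_add continuous_on_add)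
qed

lemma GS_cmult: "f \<in> GS \<Longrightarrow> (\<lambda>x. c * f x) \<in> GS"
  by (auto simp: GS_iff fourier_cmult[abs_def] intro!: exp_decay_cmult continuous_on_mult_left)

lemma GS_cnj: assumes f: "f \<in> GS" shows "(\<lambda>x. cnj (f x)) \<in> GS"
  unfolding GS_iff fourier_cnj[abs_def]
proof (intro conjI)
  show "exp_decay (\<lambda>\<omega>. cnj (fourier f (- \<omega>)))"
    using exp_decay_affine[OF GS_fourier_decay[OF f], of "-1" 0, simplified]
    by (rule exp_decay_cong_norm) (simp add: complex_mod_cnj)
  show "exp_decay (\<lambda>x. cnj (f x))"
    using GS_decay[OF f] by (rule exp_decay_cong_norm) simp
qed (intro continuous_on_cnj GS_continuous[OF f])

lemma GS_uminus: assumes f: "f \<in> GS" shows "(\<lambda>x. f (- x)) \<in> GS"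
  unfolding GS_iff fourier_uminus[OF GS_measurable[OF f], abs_def]
  using exp_decay_affine[OF GS_fourier_decay[OF f], of "-1" 0] exp_decay_affine[OF GS_decay[OF f], of "-1" 0]
  by (auto intro!: continuous_on_compose2[OF GS_continuous[OF f]] continuous_intros)

lemma GS_translation: assumes f: "f \<in> GS" shows "translation p f \<in> GS"
  unfolding GS_iff
proof (intro conjI)
  show "continuous_on UNIV (translation p f)" unfolding translation_def
    by (auto intro!: continuous_on_compose2[OF GS_continuous[OF f]] continuous_intros)
  show "exp_decay (translation p f)"
    using exp_decay_affine[OF GS_decay[OF f], of 1 "- p"] by (simp add: translation_def)
  show "exp_decay (fourier (translation p f))"
    by (rule exp_decay_cong_norm[OF GS_fourier_decay[OF f]])
       (simp add: fourier_translation[OF GS_measurable[OF f]] norm_mult)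
qed

lemma GS_modulation: assumes f: "f \<in> GS" shows "modulation q f \<in> GS"
  unfolding GS_iff
proof (intro conjI)
  show "continuous_on UNIV (modulation q f)" unfolding modulation_cis[abs_def]
    by (auto intro!: continuous_intros GS_continuous[OF f])
  show "exp_decay (modulation q f)"
    by (rule exp_decay_cong_norm[OF GS_decay[OF f]]) (simp add: modulation_cis norm_mult)
  show "exp_decay (fourier (modulation q f))"
    using exp_decay_affine[OF GS_fourier_decay[OF f], of 1 "- q"]
    by (simp add: fourier_modulation[abs_def])
qed

section \<open>The Wigner transform\<close>

text \<open>
  The function of \<open>t\<close> whose Fourier transform is the Wigner transform at position \<open>x\<close>.
\<close>

definition wigner_kernel :: "('a::euclidean_space \<Rightarrow> complex) \<Rightarrow> ('a \<Rightarrow> complex) \<Rightarrow> 'a \<Rightarrow> 'a \<Rightarrow> complex" where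
  "wigner_kernel f g x t = f (x + t /\<^sub>R 2) * cnj (g (x - t /\<^sub>R 2))"

lemma wigner_eq_fourier: "wigner f g (x, \<omega>) = fourier (wigner_kernel f g x) \<omega>"
  unfolding wigner_def fourier_def wigner_kernel_def by (simp add: inner_commute)

lemma continuous_on_wigner_kernel:
  assumes "continuous_on UNIV f" "continuous_on UNIV g"
    "continuous_on UNIV p" "continuous_on UNIV q"
  shows "continuous_on UNIV (\<lambda>z. wigner_kernel f g (p z) (q z))"
  unfolding wigner_kernel_def using assms(3,4)
  by (intro continuous_intros continuous_on_compose2[OF assms(1)] continuous_on_compose2[OF assms(2)]) auto

lemma continuous_on_wigner_kernel_section:
  assumes "f \<in> GS" "g \<in> GS" shows "continuous_on UNIV (wigner_kernel f g x)"
  using continuous_on_wigner_kernel[OF GS_continuous[OF assms(1)] GS_continuous[OF assms(2)]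
      continuous_on_const continuous_on_id, of x] .

text \<open>
  The points \<open>x + t/2\<close> and \<open>x - t/2\<close> have half-sum \<open>x\<close> and difference \<open>t\<close>, so the sum of their norms
  controls both \<open>\<bar>x\<bar>\<close> and \<open>\<bar>t\<bar>\<close>.
\<close>

lemma wigner_kernel_bound:
  fixes f g :: "'a::euclidean_space \<Rightarrow> complex"
  assumes f: "exp_decay f" and g: "exp_decay g" and h: "h > 0"
  shows "\<exists>C\<ge>0. \<forall>x t. norm (wigner_kernel f g x t) \<le> C * exp (- h * norm x) * exp (- h * norm t)"
proof -
  have h2: "2 * h > 0" using h by simp
  obtain C where C: "C \<ge> 0" "\<And>x. norm (f x) \<le> C * exp (- (2 * h) * norm x)"
    using exp_decayD[OF f h2] by blast
  obtain D where D: "D \<ge> 0" "\<And>x. norm (g x) \<le> D * exp (- (2 * h) * norm x)"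
    using exp_decayD[OF g h2] by blast
  have aux: "2 * u \<le> v \<Longrightarrow> w \<le> v \<Longrightarrow> 0 \<le> u \<Longrightarrow> u + w \<le> 2 * v" for u v w :: real by linarith
  show ?thesis
  proof (intro exI[of _ "C * D"] conjI allI)
    fix x t :: 'a
    let ?a = "norm (x + t /\<^sub>R 2)" and ?b = "norm (x - t /\<^sub>R 2)"
    have "2 * norm x \<le> ?a + ?b"
      using norm_triangle_ineq[of "x + t /\<^sub>R 2" "x - t /\<^sub>R 2"] by (simp add: scaleR_2[symmetric])
    moreover have "norm t \<le> ?a + ?b"
      using norm_triangle_ineq4[of "x + t /\<^sub>R 2" "x - t /\<^sub>R 2"] by (simp add: scaleR_2[symmetric])
    ultimately have "h * (norm x + norm t) \<le> h * (2 * (?a + ?b))"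
      using norm_ge_zero[of x] by (intro mult_left_mono less_imp_le[OF h] aux)
    then have "- (2 * h) * ?a + - (2 * h) * ?b \<le> - h * norm x + - h * norm t"
      by (simp add: algebra_simps)
    then have *: "exp (- (2 * h) * ?a) * exp (- (2 * h) * ?b) \<le> exp (- h * norm x) * exp (- h * norm t)"
      by (simp only: exp_add[symmetric] exp_le_cancel_iff)
    have "norm (wigner_kernel f g x t) \<le> (C * exp (- (2 * h) * ?a)) * (D * exp (- (2 * h) * ?b))"
      unfolding wigner_kernel_def norm_mult complex_mod_cnj using C D by (intro mult_mono) auto
    also have "\<dots> = C * D * (exp (- (2 * h) * ?a) * exp (- (2 * h) * ?b))"
      by (simp only: mult_ac)
    also have "\<dots> \<le> C * D * (exp (- h * norm x) * exp (- h * norm t))"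
      using * C(1) D(1) by (intro mult_left_mono) auto
    finally show "norm (wigner_kernel f g x t) \<le> C * D * exp (- h * norm x) * exp (- h * norm t)"
      by (simp only: mult.assoc)
  qed (use C(1) D(1) in simp)
qed

lemma wigner_kernel_decay:
  assumes "exp_decay f" "exp_decay g" shows "exp_decay (wigner_kernel f g x)"
proof (rule exp_decayI)
  fix h :: real assume "h > 0"
  from wigner_kernel_bound[OF assms this]
  obtain C where C: "C \<ge> 0" "\<And>t. norm (wigner_kernel f g x t) \<le> C * exp (- h * norm x) * exp (- h * norm t)"
    by blast
  then show "\<exists>C\<ge>0. \<forall>t. norm (wigner_kernel f g x t) \<le> C * exp (- h * norm t)"
    by (intro exI[of _ "C * exp (- h * norm x)"]) auto
qed

lemma wigner_kernel_integrable:
  assumes f: "f \<in> GS" and g: "g \<in> GS" shows "integrable lborel (wigner_kernel f g x)"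
proof (rule exp_decay_integrable)
  show "exp_decay (wigner_kernel f g x)"
    by (rule wigner_kernel_decay[OF GS_decay[OF f] GS_decay[OF g]])
  show "wigner_kernel f g x \<in> borel_measurable borel"
    by (rule borel_measurable_continuous_onI[OF continuous_on_wigner_kernel_section[OF f g]])
qed

lemma norm_fourier_le:
  assumes w: "integrable lborel w" and le: "\<And>t. norm (f t) \<le> w t"
  shows "norm (fourier f \<omega>) \<le> (\<integral>t. w t \<partial>lborel)"
proof -
  have "norm (fourier f \<omega>) \<le> (\<integral>t. norm (f t) \<partial>lborel)"
    using integral_norm_bound[of lborel "\<lambda>t. f t * cis (- (2 * pi * (t \<bullet> \<omega>)))"]
    unfolding fourier_cis by (simp add: norm_mult)
  also have "\<dots> \<le> (\<integral>t. w t \<partial>lborel)"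
    using le order.trans[OF norm_ge_zero le] by (intro integral_mono'[OF w]) auto
  finally show ?thesis .
qed

lemma wigner_decay_fst:
  fixes f g :: "'a::euclidean_space \<Rightarrow> complex"
  assumes f: "exp_decay f" and g: "exp_decay g" and h: "h > 0"
  shows "\<exists>C\<ge>0. \<forall>x \<omega>. norm (wigner f g (x, \<omega>)) \<le> C * exp (- h * norm x)"
proof -
  obtain C where C: "C \<ge> 0"
    "\<And>x t. norm (wigner_kernel f g x t) \<le> C * exp (- h * norm x) * exp (- h * norm t)"
    using wigner_kernel_bound[OF f g h] by blast
  let ?I = "integral\<^sup>L lborel (\<lambda>t::'a. exp (- h * norm t))"
  have "integrable lborel (\<lambda>t::'a. C * exp (- h * norm x) * exp (- h * norm t))" for x :: 'a
    using h by (intro integrable_mult_right integrable_exp_neg_norm)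
  then have "norm (wigner f g (x, \<omega>)) \<le> integral\<^sup>L lborel (\<lambda>t::'a. C * exp (- h * norm x) * exp (- h * norm t))" for x \<omega>
    unfolding wigner_eq_fourier by (rule norm_fourier_le) (rule C(2))
  then have "norm (wigner f g (x, \<omega>)) \<le> C * exp (- h * norm x) * ?I" for x \<omega>
    by (simp only: integral_mult_right_zero)
  moreover have "?I \<ge> 0" by simp
  ultimately show ?thesis
    using C(1) by (intro exI[of _ "C * ?I"] conjI allI mult_nonneg_nonneg) (simp_all only: mult_ac)
qed

lemma continuous_on_wigner:
  fixes f g :: "'a::euclidean_space \<Rightarrow> complex"
  assumes f: "f \<in> GS" and g: "g \<in> GS"
  shows "continuous_on UNIV (wigner f g)"
proof -
  obtain C where C: "C \<ge> 0"
    "\<And>x t. norm (wigner_kernel f g x t) \<le> C * exp (- 1 * norm x) * exp (- 1 * norm t)"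
    using wigner_kernel_bound[OF GS_decay[OF f] GS_decay[OF g], of 1] by auto
  let ?F = "\<lambda>z t. wigner_kernel f g (fst z) t * cis (- (2 * pi * (t \<bullet> snd z)))"
  have "continuous_on UNIV (\<lambda>z. \<integral>t. ?F z t \<partial>lborel)"
  proof (rule continuous_on_integral_dominated)
    show "continuous_on UNIV (\<lambda>z. ?F z t)" for t
      by (intro continuous_on_mult continuous_on_wigner_kernel GS_continuous f g continuous_on_cis)
         (intro continuous_intros)+
    show "?F z \<in> borel_measurable borel" for z
      by (intro borel_measurable_continuous_onI continuous_on_mult continuous_on_wigner_kernel GS_continuous f g continuous_on_cis)
         (intro continuous_intros)+
    show "integrable lborel (\<lambda>t::'a. C * exp (- 1 * norm t))"
      by (intro integrable_mult_right integrable_exp_neg_norm) simp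
    show "norm (?F z t) \<le> C * exp (- 1 * norm t)" for z t
    proof -
      have "norm (?F z t) \<le> C * exp (- 1 * norm (fst z)) * exp (- 1 * norm t)"
        using C(2)[of "fst z" t] by (simp add: norm_mult)
      also have "\<dots> \<le> C * 1 * exp (- 1 * norm t)"
        using C(1) by (intro mult_right_mono mult_left_mono) auto
      finally show ?thesis by simp
    qed
  qed
  moreover have "wigner f g = (\<lambda>z. \<integral>t. ?F z t \<partial>lborel)"
    by (rule ext) (simp add: wigner_eq_fourier[symmetric] fourier_cis[symmetric])
  ultimately show ?thesis by simp
qed

text \<open>
  Write \<open>f (x + t/2)\<close> by Fourier inversion as an integral over a frequency \<open>\<xi>\<close>.  The integral over \<open>t\<close>
  then becomes the conjugate Fourier transform of \<open>g\<close> at \<open>2 \<omega> - \<xi>\<close>, and \<open>\<xi> = \<omega> + \<eta>/2\<close> puts the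
  result into the form of a Wigner transform.  The identity rotates phase space by a right angle
  and thereby turns decay in position into decay in frequency.
\<close>

lemma wigner_fourier:
  fixes f g :: "'a::euclidean_space \<Rightarrow> complex"
  assumes f: "f \<in> GS" and g: "g \<in> GS"
  shows "wigner f g (x, \<omega>) = wigner (fourier f) (fourier g) (\<omega>, - x)"
proof -
  note [measurable] = GS_measurable[OF g]
    borel_measurable_continuous_onI[OF GS_fourier_continuous[OF f]]
    borel_measurable_continuous_onI[OF GS_fourier_continuous[OF g]]
  let ?N = "2 ^ DIM('a) :: real"
  let ?H = "\<lambda>t \<xi>. fourier f \<xi> * cis (2 * pi * ((x + t /\<^sub>R 2) \<bullet> \<xi>)) * cnj (g (x - t /\<^sub>R 2))
      * cis (- (2 * pi * (t \<bullet> \<omega>)))"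
  let ?P = "\<lambda>\<xi>. fourier f \<xi> * cnj (fourier g (2 *\<^sub>R \<omega> - \<xi>)) * cis (2 * pi * ((2 *\<^sub>R x) \<bullet> (\<xi> - \<omega>)))"
  have gx: "integrable lborel (\<lambda>t. g (x - t /\<^sub>R 2))"
    using integrable_lborel_affine[OF GS_integrable[OF g], of "- (1/2)" x] by simp
  have H: "integrable lborel (\<lambda>(t, \<xi>). ?H t \<xi>)"
  proof (rule integrable_lborel_pair_bound[OF _ integrable_norm[OF gx] integrable_norm[OF GS_fourier_integrable[OF f]]])
    show "(\<lambda>(t, \<xi>). ?H t \<xi>) \<in> borel_measurable (borel \<Otimes>\<^sub>M borel)" by measurable
    show "norm (case (t, \<xi>) of (t, \<xi>) \<Rightarrow> ?H t \<xi>) \<le> norm (g (x - t /\<^sub>R 2)) * norm (fourier f \<xi>)" for t \<xi>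
      by (simp add: norm_mult)
  qed
  have "wigner f g (x, \<omega>) = (\<integral>t. (\<integral>\<xi>. ?H t \<xi> \<partial>lborel) \<partial>lborel)"
    unfolding wigner_eq_fourier fourier_cis[of "wigner_kernel f g x"] wigner_kernel_def
    by (simp only: integral_mult_left_zero GS_fourier_inversion[OF f])
  also have "\<dots> = (\<integral>\<xi>. (\<integral>t. ?H t \<xi> \<partial>lborel) \<partial>lborel)"
    using integral_lborel_swap[OF H] by simp
  also have "\<dots> = (\<integral>\<xi>. ?N *\<^sub>R ?P \<xi> \<partial>lborel)"
  proof (intro Bochner_Integration.integral_cong refl)
    fix \<xi>
    have "(\<integral>t. ?H t \<xi> \<partial>lborel) = ?N *\<^sub>R (\<integral>s. ?H (2 *\<^sub>R x + (- 2) *\<^sub>R s) \<xi> \<partial>lborel)"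
      by (subst integral_lborel_affine[where t="2 *\<^sub>R x" and c="-2"]) simp_all
    also have "(\<lambda>s. ?H (2 *\<^sub>R x + (- 2) *\<^sub>R s) \<xi>) = (\<lambda>s. fourier f \<xi> * cis (2 * pi * ((2 *\<^sub>R x) \<bullet> (\<xi> - \<omega>)))
        * (cnj (g s * cis (- (2 * pi * (s \<bullet> (2 *\<^sub>R \<omega> - \<xi>)))))))"
    proof
      fix s
      have 1: "x + (2 *\<^sub>R x + (- 2) *\<^sub>R s) /\<^sub>R 2 = 2 *\<^sub>R x - s"
        by (simp only: scaleR_add_right scaleR_scaleR) (simp add: scaleR_2)
      have 2: "x - (2 *\<^sub>R x + (- 2) *\<^sub>R s) /\<^sub>R 2 = s"
        by (simp only: scaleR_add_right scaleR_scaleR) (simp add: scaleR_2)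
      have 3: "cis (2 * pi * ((2 *\<^sub>R x - s) \<bullet> \<xi>)) * cis (- (2 * pi * ((2 *\<^sub>R x + (- 2) *\<^sub>R s) \<bullet> \<omega>)))
        = cis (2 * pi * ((2 *\<^sub>R x) \<bullet> (\<xi> - \<omega>))) * cis (2 * pi * (s \<bullet> (2 *\<^sub>R \<omega> - \<xi>)))"
        unfolding cis_mult by (rule arg_cong[of _ _ cis]) (simp add: inner_simps algebra_simps)
      have 4: "cnj (g s * cis (- (2 * pi * (s \<bullet> (2 *\<^sub>R \<omega> - \<xi>))))) = cnj (g s) * cis (2 * pi * (s \<bullet> (2 *\<^sub>R \<omega> - \<xi>)))"
        by (simp add: cis_cnj)
      show "?H (2 *\<^sub>R x + (- 2) *\<^sub>R s) \<xi> = fourier f \<xi> * cis (2 * pi * ((2 *\<^sub>R x) \<bullet> (\<xi> - \<omega>)))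
        * (cnj (g s * cis (- (2 * pi * (s \<bullet> (2 *\<^sub>R \<omega> - \<xi>))))))"
        unfolding 1 2 4 using arg_cong[OF 3, of "\<lambda>u. fourier f \<xi> * cnj (g s) * u"]
        by (simp only: mult_ac)
    qed
    also have "?N *\<^sub>R (\<integral>s. fourier f \<xi> * cis (2 * pi * ((2 *\<^sub>R x) \<bullet> (\<xi> - \<omega>)))
        * (cnj (g s * cis (- (2 * pi * (s \<bullet> (2 *\<^sub>R \<omega> - \<xi>)))))) \<partial>lborel) = ?N *\<^sub>R ?P \<xi>"
      unfolding fourier_cis[of g] integral_mult_right_zero Bochner_Integration.integral_cnj
      by (simp only: mult_ac)
    finally show "(\<integral>t. ?H t \<xi> \<partial>lborel) = ?N *\<^sub>R ?P \<xi>" .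
  qed
  also have "\<dots> = (1/2) ^ DIM('a) *\<^sub>R (\<integral>\<eta>. ?N *\<^sub>R ?P (\<omega> + (1/2) *\<^sub>R \<eta>) \<partial>lborel)"
    by (subst integral_lborel_affine[where t=\<omega> and c="1/2"]) simp_all
  also have "\<dots> = (\<integral>\<eta>. ?P (\<omega> + (1/2) *\<^sub>R \<eta>) \<partial>lborel)"
    by (simp add: power_divide)
  also have "\<dots> = wigner (fourier f) (fourier g) (\<omega>, - x)"
    unfolding wigner_eq_fourier fourier_cis[of "wigner_kernel (fourier f) (fourier g) \<omega>"] wigner_kernel_def
  proof (intro Bochner_Integration.integral_cong refl)
    fix \<eta>
    have 1: "2 *\<^sub>R \<omega> - (\<omega> + (1/2) *\<^sub>R \<eta>) = \<omega> - \<eta> /\<^sub>R 2" "\<omega> + (1/2) *\<^sub>R \<eta> = \<omega> + \<eta> /\<^sub>R 2"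
      by (simp_all add: scaleR_2)
    have 2: "2 * pi * ((2 *\<^sub>R x) \<bullet> (\<omega> + (1/2) *\<^sub>R \<eta> - \<omega>)) = - (2 * pi * (\<eta> \<bullet> - x))"
      by (simp add: inner_commute)
    show "?P (\<omega> + (1/2) *\<^sub>R \<eta>) = fourier f (\<omega> + \<eta> /\<^sub>R 2) * cnj (fourier g (\<omega> - \<eta> /\<^sub>R 2)) * cis (- (2 * pi * (\<eta> \<bullet> - x)))"
      unfolding 2 unfolding 1(1) unfolding 1(2) ..
  qed
  finally show ?thesis .
qed

lemma wigner_decay:
  fixes f g :: "'a::euclidean_space \<Rightarrow> complex"
  assumes f: "f \<in> GS" and g: "g \<in> GS"
  shows "exp_decay (wigner f g)"
proof (rule exp_decay_pair)
  fix h :: real assume h: "h > 0"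
  show "\<exists>C\<ge>0. \<forall>x y. norm (wigner f g (x, y)) \<le> C * exp (- h * norm x)"
    by (rule wigner_decay_fst[OF GS_decay[OF f] GS_decay[OF g] h])
  show "\<exists>C\<ge>0. \<forall>x y. norm (wigner f g (x, y)) \<le> C * exp (- h * norm y)"
    using wigner_decay_fst[OF GS_fourier_decay[OF f] GS_fourier_decay[OF g] h]
    unfolding wigner_fourier[OF f g] by blast
qed

lemma wigner_section_integrable:
  fixes f g :: "'a::euclidean_space \<Rightarrow> complex"
  assumes f: "f \<in> GS" and g: "g \<in> GS"
  shows "integrable lborel (fourier (wigner_kernel f g x))"
proof (rule exp_decay_integrable)
  show "fourier (wigner_kernel f g x) \<in> borel_measurable borel"
    by (intro borel_measurable_continuous_onI continuous_on_fourier wigner_kernel_integrable f g)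
  show "exp_decay (fourier (wigner_kernel f g x))"
  proof (rule exp_decayI)
    fix h :: real assume "h > 0"
    from wigner_decay_fst[OF GS_fourier_decay[OF f] GS_fourier_decay[OF g] this]
    show "\<exists>C\<ge>0. \<forall>\<omega>. norm (fourier (wigner_kernel f g x) \<omega>) \<le> C * exp (- h * norm \<omega>)"
      unfolding wigner_eq_fourier[symmetric] wigner_fourier[OF f g] by blast
  qed
qed

lemma wigner_integrable:
  fixes f g :: "'a::euclidean_space \<Rightarrow> complex"
  assumes f: "f \<in> GS" and g: "g \<in> GS"
  shows "integrable lborel (wigner f g)"
  by (intro exp_decay_integrable wigner_decay borel_measurable_continuous_onI continuous_on_wigner f g)

text \<open>
  Inversion undoes the Fourier transform that defines the Wigner transform; what is left is the
  integral of \<open>f (x - \<eta>/2) cnj (g (x + \<eta>/2))\<close> against a character in \<open>x\<close>, again of Wigner type.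
  Decay of the Fourier transform of a Wigner transform is thereby decay of a Wigner transform.
\<close>

lemma fourier_wigner:
  fixes f g :: "'a::euclidean_space \<Rightarrow> complex"
  assumes f: "f \<in> GS" and g: "g \<in> GS"
  shows "fourier (wigner f g) (\<xi>, \<eta>)
    = (1/2) ^ DIM('a) *\<^sub>R wigner f (\<lambda>y. g (- y)) (- \<eta> /\<^sub>R 2, \<xi> /\<^sub>R 2)"
proof -
  let ?K = "wigner_kernel f g"
  let ?F = "\<lambda>z. wigner f g z * cis (- (2 * pi * (z \<bullet> (\<xi>, \<eta>))))"
  note [measurable] = GS_measurable[OF f] GS_measurable[OF g]
  have [measurable]: "wigner f g \<in> borel_measurable borel"
    by (intro borel_measurable_continuous_onI continuous_on_wigner f g)
  have int: "integrable lborel ?F"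
    by (rule Bochner_Integration.integrable_bound[OF wigner_integrable[OF f g]]) (measurable, simp add: norm_mult)
  have "fourier (wigner f g) (\<xi>, \<eta>) = (\<integral>x. (\<integral>\<omega>. ?F (x, \<omega>) \<partial>lborel) \<partial>lborel)"
    unfolding fourier_cis by (rule integral_lborel_pair[OF int])
  also have "\<dots> = (\<integral>x. cis (- (2 * pi * (x \<bullet> \<xi>))) * ?K x (- \<eta>) \<partial>lborel)"
  proof (intro Bochner_Integration.integral_cong refl)
    fix x
    have 1: "?F (x, \<omega>) = cis (- (2 * pi * (x \<bullet> \<xi>))) * (fourier (?K x) \<omega> * cis (2 * pi * (- \<eta> \<bullet> \<omega>)))" for \<omega>
    proof -
      have "cis (- (2 * pi * ((x, \<omega>) \<bullet> (\<xi>, \<eta>)))) = cis (- (2 * pi * (x \<bullet> \<xi>))) * cis (2 * pi * (- \<eta> \<bullet> \<omega>))"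
        by (simp add: cis_mult inner_commute algebra_simps)
      then show ?thesis by (simp add: wigner_eq_fourier)
    qed
    obtain B where B: "\<And>t. norm (?K x t) \<le> B"
      using exp_decay_bounded[OF wigner_kernel_decay[OF GS_decay[OF f] GS_decay[OF g]]] by blast
    have "(\<integral>\<omega>. fourier (?K x) \<omega> * cis (2 * pi * (- \<eta> \<bullet> \<omega>)) \<partial>lborel) = ?K x (- \<eta>)"
      by (rule fourier_inversion[OF _ B wigner_kernel_integrable[OF f g] wigner_section_integrable[OF f g]])
         (rule continuous_on_wigner_kernel_section[OF f g])
    then show "(\<integral>\<omega>. ?F (x, \<omega>) \<partial>lborel) = cis (- (2 * pi * (x \<bullet> \<xi>))) * ?K x (- \<eta>)"
      unfolding 1 by simp
  qed
  also have "\<dots> = (1/2) ^ DIM('a) *\<^sub>R (\<integral>s. cis (- (2 * pi * ((0 + (1/2) *\<^sub>R s) \<bullet> \<xi>))) * ?K (0 + (1/2) *\<^sub>R s) (- \<eta>) \<partial>lborel)"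
    unfolding wigner_kernel_def by (subst integral_lborel_affine[where t=0 and c="1/2"]) simp_all
  also have "(\<lambda>s. cis (- (2 * pi * ((0 + (1/2) *\<^sub>R s) \<bullet> \<xi>))) * ?K (0 + (1/2) *\<^sub>R s) (- \<eta>))
      = (\<lambda>s. wigner_kernel f (\<lambda>y. g (- y)) (- \<eta> /\<^sub>R 2) s * cis (- (2 * pi * (s \<bullet> (\<xi> /\<^sub>R 2)))))"
    by (rule ext) (simp add: wigner_kernel_def add.commute)
  finally show ?thesis unfolding wigner_eq_fourier fourier_cis .
qed

lemma GS_wigner:
  fixes f g :: "'a::euclidean_space \<Rightarrow> complex"
  assumes f: "f \<in> GS" and g: "g \<in> GS"
  shows "wigner f g \<in> GS"
  unfolding GS_iff
proof (intro conjI)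
  show "continuous_on UNIV (wigner f g)" by (rule continuous_on_wigner[OF f g])
  show "exp_decay (wigner f g)" by (rule wigner_decay[OF f g])
  let ?W = "wigner f (\<lambda>y. g (- y))"
  have W: "exp_decay ?W" by (rule wigner_decay[OF f GS_uminus[OF g]])
  have "exp_decay (\<lambda>z. ?W (- snd z /\<^sub>R 2, fst z /\<^sub>R 2))"
  proof (rule exp_decayI)
    fix h :: real assume "h > 0"
    then have "2 * h > 0" by simp
    from exp_decayD[OF W this] obtain C
      where C: "C \<ge> 0" "\<And>z. norm (?W z) \<le> C * exp (- (2 * h) * norm z)" by blast
    have "norm (- y /\<^sub>R 2, x /\<^sub>R 2) = norm (x, y) / 2" for x y :: 'a
    proof -
      have "(- y /\<^sub>R 2, x /\<^sub>R 2) = (1/2) *\<^sub>R (- y, x)" by simp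
      also have "norm \<dots> = norm (x, y) / 2" by (simp only: norm_scaleR) (simp add: norm_Pair add.commute)
      finally show ?thesis .
    qed
    then have n: "- (2 * h) * norm (- snd z /\<^sub>R 2, fst z /\<^sub>R 2) = - h * norm z" for z :: "'a \<times> 'a"
      by (simp only: prod.collapse)
    have "norm (?W (- snd z /\<^sub>R 2, fst z /\<^sub>R 2)) \<le> C * exp (- h * norm z)" for z
      using C(2)[of "(- snd z /\<^sub>R 2, fst z /\<^sub>R 2)"] unfolding n .
    then show "\<exists>C\<ge>0. \<forall>z. norm (?W (- snd z /\<^sub>R 2, fst z /\<^sub>R 2)) \<le> C * exp (- h * norm z)"
      using C(1) by blast
  qed
  then have "exp_decay (\<lambda>z. (1/2) ^ DIM('a) * ?W (- snd z /\<^sub>R 2, fst z /\<^sub>R 2))"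
    by (rule exp_decay_cmult)
  then show "exp_decay (fourier (wigner f g))"
    by (rule exp_decay_cong_norm) (auto simp: fourier_wigner[OF f g] scaleR_conv_of_real)
qed

text \<open>
  The map \<open>(x, t) \<mapsto> (x + t/2, x - t/2)\<close> has Jacobian \<open>1\<close> in absolute value.  It is carried out as two
  substitutions in one variable each, whose factors \<open>2 ^ DIM('a)\<close> and \<open>2 ^ - DIM('a)\<close> cancel.
\<close>

lemma integral_midpoint:
  fixes A B :: "'a::euclidean_space \<Rightarrow> complex"
  assumes A: "continuous_on UNIV A" "exp_decay A" and B: "continuous_on UNIV B" "exp_decay B"
  shows "(\<integral>x. (\<integral>t. A (x + t /\<^sub>R 2) * B (x - t /\<^sub>R 2) \<partial>lborel) \<partial>lborel)
    = (\<integral>x. A x \<partial>lborel) * (\<integral>x. B x \<partial>lborel)"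
proof -
  let ?N = "2 ^ DIM('a) :: real"
  have [measurable]: "A \<in> borel_measurable borel" "B \<in> borel_measurable borel"
    using A(1) B(1) by (auto intro: borel_measurable_continuous_onI)
  let ?J = "\<lambda>x s. A s * (?N *\<^sub>R B (- s + 2 *\<^sub>R x))"
  obtain C where C: "C \<ge> 0" "\<And>x. norm (A x) \<le> C * exp (- 1 * norm x)"
    using exp_decayD[OF A(2), of 1] by auto
  obtain D where D: "D \<ge> 0" "\<And>x. norm (B x) \<le> D * exp (- 1 * norm x)"
    using exp_decayD[OF B(2), of 1] by auto
  have int1: "integrable lborel (\<lambda>x::'a. C * D * ?N * exp (- 1 * norm x))"
    and int2: "integrable lborel (\<lambda>x::'a. exp (- (1/2) * norm x))"
    by (intro integrable_mult_right integrable_exp_neg_norm; simp)+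
  have J: "integrable lborel (\<lambda>(x, s). ?J x s)"
  proof (rule integrable_lborel_pair_bound[OF _ int1 int2])
    show "(\<lambda>(x, s). ?J x s) \<in> borel_measurable (borel \<Otimes>\<^sub>M borel)" by measurable
    fix x s :: 'a
    have "2 * norm x \<le> norm s + norm (- s + 2 *\<^sub>R x)"
      using norm_triangle_ineq[of s "- s + 2 *\<^sub>R x"] by simp
    then have "- 1 * norm s + - 1 * norm (- s + 2 *\<^sub>R x) \<le> - 1 * norm x + - (1/2) * norm s"
      using norm_ge_zero[of "- s + 2 *\<^sub>R x"] by linarith
    then have *: "exp (- 1 * norm s) * exp (- 1 * norm (- s + 2 *\<^sub>R x)) \<le> exp (- 1 * norm x) * exp (- (1/2) * norm s)"
      by (simp only: exp_add[symmetric] exp_le_cancel_iff)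
    have "norm (?J x s) = ?N * (norm (A s) * norm (B (- s + 2 *\<^sub>R x)))"
      by (simp add: norm_mult)
    also have "\<dots> \<le> ?N * ((C * exp (- 1 * norm s)) * (D * exp (- 1 * norm (- s + 2 *\<^sub>R x))))"
      using C D by (intro mult_left_mono mult_mono) auto
    also have "\<dots> = C * D * ?N * (exp (- 1 * norm s) * exp (- 1 * norm (- s + 2 *\<^sub>R x)))"
      by (simp only: mult_ac)
    also have "\<dots> \<le> C * D * ?N * (exp (- 1 * norm x) * exp (- (1/2) * norm s))"
      using * C(1) D(1) by (intro mult_left_mono) auto
    finally show "norm (case (x, s) of (x, s) \<Rightarrow> ?J x s) \<le> C * D * ?N * exp (- 1 * norm x) * exp (- (1/2) * norm s)"
      by (simp only: mult.assoc prod.case)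
  qed
  have "(\<integral>t. A (x + t /\<^sub>R 2) * B (x - t /\<^sub>R 2) \<partial>lborel) = (\<integral>s. ?J x s \<partial>lborel)" for x
  proof -
    have 1: "x + ((- 2) *\<^sub>R x + 2 *\<^sub>R s) /\<^sub>R 2 = s" "x - ((- 2) *\<^sub>R x + 2 *\<^sub>R s) /\<^sub>R 2 = - s + 2 *\<^sub>R x" for s
      by (simp_all only: scaleR_add_right scaleR_scaleR) (simp_all add: scaleR_2)
    have "(\<integral>t. A (x + t /\<^sub>R 2) * B (x - t /\<^sub>R 2) \<partial>lborel)
        = ?N *\<^sub>R (\<integral>s. A (x + ((- 2) *\<^sub>R x + 2 *\<^sub>R s) /\<^sub>R 2) * B (x - ((- 2) *\<^sub>R x + 2 *\<^sub>R s) /\<^sub>R 2) \<partial>lborel)"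
      by (subst integral_lborel_affine[where t="(- 2) *\<^sub>R x" and c=2]) simp_all
    also have "\<dots> = (\<integral>s. ?J x s \<partial>lborel)" unfolding 1 by simp
    finally show ?thesis .
  qed
  then have "(\<integral>x. (\<integral>t. A (x + t /\<^sub>R 2) * B (x - t /\<^sub>R 2) \<partial>lborel) \<partial>lborel) = (\<integral>x. (\<integral>s. ?J x s \<partial>lborel) \<partial>lborel)"
    by simp
  also have "\<dots> = (\<integral>s. (\<integral>x. ?J x s \<partial>lborel) \<partial>lborel)"
    using integral_lborel_swap[OF J] by simp
  also have "\<dots> = (\<integral>s. A s * (\<integral>x. B x \<partial>lborel) \<partial>lborel)"
  proof (intro Bochner_Integration.integral_cong refl)
    fix s
    have "(\<integral>x. B x \<partial>lborel) = ?N *\<^sub>R (\<integral>x. B (- s + 2 *\<^sub>R x) \<partial>lborel)"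
      by (subst integral_lborel_affine[where t="- s" and c=2]) simp_all
    then show "(\<integral>x. ?J x s \<partial>lborel) = A s * (\<integral>x. B x \<partial>lborel)"
      by (simp only: integral_mult_right_zero integral_scaleR_right)
  qed
  finally show ?thesis by simp
qed

text \<open>
  Parseval's identity in the frequency variable removes the Fourier transforms, and the remaining
  double integral separates in the coordinates \<open>x + t/2\<close> and \<open>x - t/2\<close>.
\<close>

theorem wigner_moyal:
  fixes f1 f2 g1 g2 :: "'a::euclidean_space \<Rightarrow> complex"
  assumes f: "f1 \<in> GS" "f2 \<in> GS" and g: "g1 \<in> GS" "g2 \<in> GS"
  shows "(\<integral>z. wigner f1 f2 z * cnj (wigner g1 g2 z) \<partial>lborel)
    = (\<integral>t. f1 t * cnj (g1 t) \<partial>lborel) * cnj (\<integral>t. f2 t * cnj (g2 t) \<partial>lborel)"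
proof -
  have W: "wigner f1 f2 \<in> GS" "wigner g1 g2 \<in> GS" using f g by (auto intro: GS_wigner)
  have "integrable lborel (\<lambda>z. wigner f1 f2 z * cnj (wigner g1 g2 z))"
    by (intro exp_decay_integrable exp_decay_mult GS_decay[OF W(1)] GS_decay[OF GS_cnj[OF W(2)]]
        borel_measurable_continuous_onI continuous_on_mult continuous_on_cnj GS_continuous W)
  then have "(\<integral>z. wigner f1 f2 z * cnj (wigner g1 g2 z) \<partial>lborel)
      = (\<integral>x. (\<integral>\<omega>. wigner f1 f2 (x, \<omega>) * cnj (wigner g1 g2 (x, \<omega>)) \<partial>lborel) \<partial>lborel)"
    by (rule integral_lborel_pair)
  also have "\<dots> = (\<integral>x. (\<integral>t. (f1 (x + t /\<^sub>R 2) * cnj (g1 (x + t /\<^sub>R 2)))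
      * cnj (f2 (x - t /\<^sub>R 2) * cnj (g2 (x - t /\<^sub>R 2))) \<partial>lborel) \<partial>lborel)"
  proof (rule Bochner_Integration.integral_cong[OF refl])
    fix x
    obtain B where B: "\<And>t. norm (wigner_kernel f1 f2 x t) \<le> B"
      using exp_decay_bounded[OF wigner_kernel_decay[OF GS_decay[OF f(1)] GS_decay[OF f(2)]]] by blast
    have "(\<integral>\<omega>. wigner f1 f2 (x, \<omega>) * cnj (wigner g1 g2 (x, \<omega>)) \<partial>lborel)
        = (\<integral>t. wigner_kernel f1 f2 x t * cnj (wigner_kernel g1 g2 x t) \<partial>lborel)"
      unfolding wigner_eq_fourier
      by (rule fourier_parseval[OF _ B wigner_kernel_integrable[OF f] wigner_section_integrable[OF f]
            wigner_kernel_integrable[OF g]])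
         (rule continuous_on_wigner_kernel_section[OF f])
    then show "(\<integral>\<omega>. wigner f1 f2 (x, \<omega>) * cnj (wigner g1 g2 (x, \<omega>)) \<partial>lborel)
        = (\<integral>t. (f1 (x + t /\<^sub>R 2) * cnj (g1 (x + t /\<^sub>R 2)))
            * cnj (f2 (x - t /\<^sub>R 2) * cnj (g2 (x - t /\<^sub>R 2))) \<partial>lborel)"
      unfolding wigner_kernel_def by (simp add: mult_ac)
  qed
  also have "\<dots> = (\<integral>t. f1 t * cnj (g1 t) \<partial>lborel) * (\<integral>t. cnj (f2 t * cnj (g2 t)) \<partial>lborel)"
  proof (rule integral_midpoint[where A="\<lambda>t. f1 t * cnj (g1 t)" and B="\<lambda>t. cnj (f2 t * cnj (g2 t))"])
    show "exp_decay (\<lambda>t. f1 t * cnj (g1 t))"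
      by (intro exp_decay_mult GS_decay f GS_cnj g)
    show "exp_decay (\<lambda>t. cnj (f2 t * cnj (g2 t)))"
      unfolding complex_cnj_mult complex_cnj_cnj by (intro exp_decay_mult GS_decay f GS_cnj g)
  qed (intro continuous_on_mult continuous_on_cnj GS_continuous f g)+
  finally show ?thesis by (simp only: Bochner_Integration.integral_cnj)
qed

section \<open>Tensor products\<close>

lemma measurable_vec_lambda:
  "(\<lambda>f. \<chi> i. f i) \<in> (\<Pi>\<^sub>M i\<in>UNIV. lborel) \<rightarrow>\<^sub>M (borel :: ('a::euclidean_space ^ 'n::finite) measure)"
proof (subst borel_measurable_euclidean_space, intro ballI)
  fix b :: "'a ^ 'n" assume "b \<in> Basis"
  then obtain i c where b: "b = axis i c" by (auto simp: Basis_vec_def)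
  have "(\<lambda>f. f i \<bullet> c) \<in> borel_measurable (\<Pi>\<^sub>M i\<in>(UNIV::'n set). (lborel :: 'a measure))"
    by measurable
  then show "(\<lambda>f. (\<chi> i. f i) \<bullet> b) \<in> borel_measurable (\<Pi>\<^sub>M i\<in>UNIV. lborel)"
    unfolding b by (simp add: inner_axis)
qed

lemma prod_Basis_vec:
  "(\<Prod>b\<in>(Basis :: ('a::euclidean_space ^ 'n::finite) set). F b) = (\<Prod>i\<in>UNIV. \<Prod>c\<in>Basis. F (axis i c))"
proof -
  have B: "(Basis :: ('a ^ 'n) set) = (\<lambda>(i, c). axis i c) ` (UNIV \<times> Basis)"
    by (auto simp: Basis_vec_def)
  have "inj_on (\<lambda>(i, c). axis i c :: 'a ^ 'n) (UNIV \<times> Basis)"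
    by (auto simp: inj_on_def axis_eq_axis)
  then show ?thesis
    unfolding B by (simp add: prod.reindex prod.cartesian_product case_prod_unfold)
qed

text \<open>
  The splitting is into blocks and not into single coordinates, since tensor products factor along
  blocks.
\<close>

lemma lborel_vec:
  "(lborel :: ('a::euclidean_space ^ 'n::finite) measure) = distr (\<Pi>\<^sub>M i\<in>UNIV. lborel) borel (\<lambda>f. \<chi> i. f i)"
proof (rule lborel_eqI)
  interpret product_sigma_finite "\<lambda>_::'n. lborel :: 'a measure" ..
  fix l u :: "'a ^ 'n" assume lu: "\<And>b. b \<in> Basis \<Longrightarrow> l \<bullet> b \<le> u \<bullet> b"
  have le: "l $ i \<bullet> c \<le> u $ i \<bullet> c" if "c \<in> Basis" for i c
    using lu[of "axis i c"] that by (simp add: inner_axis)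
  have box: "(\<lambda>f. \<chi> i. f i) -` box l u \<inter> space (\<Pi>\<^sub>M i\<in>UNIV. lborel) = (\<Pi>\<^sub>E i\<in>UNIV. box (l $ i) (u $ i))"
    by (auto simp: space_PiM mem_box Basis_vec_def inner_axis PiE_def Pi_def extensional_def)
  have "emeasure (distr (\<Pi>\<^sub>M i\<in>UNIV. lborel) borel (\<lambda>f. \<chi> i. f i)) (box l u)
      = emeasure (\<Pi>\<^sub>M i\<in>UNIV. lborel) (\<Pi>\<^sub>E i\<in>UNIV. box (l $ i) (u $ i))"
    by (subst emeasure_distr[OF measurable_vec_lambda]) (simp_all only: box sets_lborel borel_open[OF open_box])
  also have "\<dots> = (\<Prod>i\<in>UNIV. emeasure lborel (box (l $ i) (u $ i)))"
    by (rule emeasure_PiM) auto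
  also have "\<dots> = (\<Prod>i\<in>UNIV. ennreal (\<Prod>c\<in>Basis. (u $ i - l $ i) \<bullet> c))"
    using le by (intro prod.cong refl emeasure_lborel_box) auto
  also have "\<dots> = ennreal (\<Prod>i\<in>UNIV. \<Prod>c\<in>Basis. (u $ i - l $ i) \<bullet> c)"
    using le by (intro prod_ennreal prod_nonneg) (simp add: inner_diff_left)
  also have "(\<Prod>i\<in>UNIV. \<Prod>c\<in>Basis. (u $ i - l $ i) \<bullet> c) = (\<Prod>b\<in>Basis. (u - l) \<bullet> b)"
    by (simp add: prod_Basis_vec inner_axis)
  finally show "emeasure (distr (\<Pi>\<^sub>M i\<in>UNIV. lborel) borel (\<lambda>f. \<chi> i. f i)) (box l u)
      = (\<Prod>b\<in>Basis. (u - l) \<bullet> b)" .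
qed simp

lemma integral_prod_vec:
  fixes F :: "'n::finite \<Rightarrow> 'a::euclidean_space \<Rightarrow> complex"
  assumes int: "\<And>i. integrable lborel (F i)"
  shows "(\<integral>x. (\<Prod>i\<in>UNIV. F i (x $ i)) \<partial>lborel) = (\<Prod>i\<in>UNIV. \<integral>y. F i y \<partial>lborel)"
proof -
  interpret product_sigma_finite "\<lambda>_::'n. lborel :: 'a measure" ..
  have [measurable]: "F i \<in> borel_measurable borel" for i
    using borel_measurable_integrable[OF int[of i]] by simp
  have [measurable]: "(\<lambda>x::'a ^ 'n. x $ i) \<in> borel_measurable borel" for i
    by (intro borel_measurable_continuous_onI continuous_intros)
  have m: "(\<lambda>x::'a ^ 'n. \<Prod>i\<in>UNIV. F i (x $ i)) \<in> borel_measurable borel"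
    by measurable
  show ?thesis
    unfolding lborel_vec[where 'a='a]
    by (subst integral_distr[OF measurable_vec_lambda m])
       (simp only: vec_lambda_beta, rule product_integral_prod[OF finite_class.finite_UNIV int])
qed

lemma fourier_tensor:
  fixes f :: "'n::finite \<Rightarrow> real ^ 'd::finite \<Rightarrow> complex"
  assumes int: "\<And>j. integrable lborel (f j)"
  shows "fourier (tensor f) \<omega> = (\<Prod>j\<in>UNIV. fourier (f j) (\<omega> $ j))"
proof -
  have int': "integrable lborel (\<lambda>t. f j t * cis (- (2 * pi * (t \<bullet> \<omega> $ j))))" for j
  proof -
    have [measurable]: "f j \<in> borel_measurable borel" using borel_measurable_integrable[OF int[of j]] by simp
    show ?thesis
      by (rule Bochner_Integration.integrable_bound[OF int[of j]]) (measurable, simp add: norm_mult)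
  qed
  have "tensor f t * cis (- (2 * pi * (t \<bullet> \<omega>))) = (\<Prod>j\<in>UNIV. f j (t $ j) * cis (- (2 * pi * (t $ j \<bullet> \<omega> $ j))))" for t
    unfolding tensor_def prod.distrib inner_vec_def[of t]
    by (simp only: cis_sum[OF finite_class.finite_UNIV, symmetric] sum_negf sum_distrib_left)
  then show ?thesis
    unfolding fourier_cis using integral_prod_vec[OF int'] by simp
qed

text \<open>
  The norm of a vector is at most the sum of the norms of its blocks, so a product of exponentials in
  the blocks is dominated by an exponential of the same rate.
\<close>

lemma exp_decay_tensor:
  fixes f :: "'n::finite \<Rightarrow> real ^ 'd::finite \<Rightarrow> complex"
  assumes d: "\<And>j. exp_decay (f j)"
  shows "exp_decay (tensor f)"
proof (rule exp_decayI)
  fix h :: real assume h: "h > 0"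
  have "\<forall>j. \<exists>C. C \<ge> 0 \<and> (\<forall>x. norm (f j x) \<le> C * exp (- h * norm x))"
    using d h unfolding exp_decay_def by blast
  then obtain C where C: "\<And>j. C j \<ge> 0" "\<And>j x. norm (f j x) \<le> C j * exp (- h * norm x)"
    by metis
  show "\<exists>C\<ge>0. \<forall>x. norm (tensor f x) \<le> C * exp (- h * norm x)"
  proof (intro exI[of _ "\<Prod>j\<in>UNIV. C j"] conjI allI)
    fix x :: "real ^ 'd ^ 'n"
    have "norm (tensor f x) \<le> (\<Prod>j\<in>UNIV. C j * exp (- h * norm (x $ j)))"
      unfolding tensor_def prod_norm[symmetric] by (intro prod_mono conjI C norm_ge_zero)
    also have "\<dots> = (\<Prod>j\<in>UNIV. C j) * exp (\<Sum>j\<in>UNIV. - h * norm (x $ j))"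
      by (simp only: prod.distrib exp_sum[OF finite_class.finite_UNIV])
    also have "\<dots> \<le> (\<Prod>j\<in>UNIV. C j) * exp (- h * norm x)"
    proof -
      have "norm x \<le> (\<Sum>j\<in>UNIV. norm (x $ j))"
        unfolding norm_vec_def by (rule L2_set_le_sum) simp
      then have "h * norm x \<le> h * (\<Sum>j\<in>UNIV. norm (x $ j))" using h by (intro mult_left_mono) auto
      then have "(\<Sum>j\<in>UNIV. - h * norm (x $ j)) \<le> - h * norm x"
        by (simp add: sum_distrib_left sum_negf)
      then show ?thesis using C(1) by (intro mult_left_mono prod_nonneg) auto
    qed
    finally show "norm (tensor f x) \<le> (\<Prod>j\<in>UNIV. C j) * exp (- h * norm x)" .
  qed (use C(1) in \<open>auto intro: prod_nonneg\<close>)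
qed

lemma GS_tensor:
  fixes f :: "'n::finite \<Rightarrow> real ^ 'd::finite \<Rightarrow> complex"
  assumes f: "\<And>j. f j \<in> GS"
  shows "tensor f \<in> GS"
  unfolding GS_iff
proof (intro conjI)
  have "continuous_on UNIV (\<lambda>t :: real ^ 'd ^ 'n. f j (t $ j))" for j
    by (rule continuous_on_compose2[OF GS_continuous[OF f[of j]]]) (auto intro: continuous_intros)
  then show "continuous_on UNIV (tensor f)"
    unfolding tensor_def[abs_def] by (intro continuous_on_prod) auto
  show "exp_decay (tensor f)" by (intro exp_decay_tensor GS_decay f)
  have "fourier (tensor f) = tensor (\<lambda>j. fourier (f j))"
    by (rule ext) (simp add: fourier_tensor[OF GS_integrable[OF f]] tensor_def)
  then show "exp_decay (fourier (tensor f))"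
    by (simp add: exp_decay_tensor GS_fourier_decay f)
qed

lemma wigner_tensor:
  fixes f g :: "'n::finite \<Rightarrow> real ^ 'd::finite \<Rightarrow> complex"
  assumes f: "\<And>j. f j \<in> GS" and g: "\<And>j. g j \<in> GS"
  shows "wigner (tensor f) (tensor g) (x, \<omega>) = (\<Prod>j\<in>UNIV. wigner (f j) (g j) (x $ j, \<omega> $ j))"
proof -
  have "wigner_kernel (tensor f) (tensor g) x = tensor (\<lambda>j. wigner_kernel (f j) (g j) (x $ j))"
    by (rule ext) (simp add: wigner_kernel_def tensor_def prod.distrib)
  then show ?thesis
    unfolding wigner_eq_fourier
    using fourier_tensor[of "\<lambda>j. wigner_kernel (f j) (g j) (x $ j)", OF wigner_kernel_integrable[OF f g]] by simp
qed

section \<open>Convolution with a test function\<close>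

text \<open>
  The convolution of \<open>\<psi>\<close> with the reflection \<open>u \<mapsto> \<Phi> (- u)\<close>, hence the transpose of convolution with
  \<open>\<Phi>\<close>.
\<close>

definition reflected_conv :: "('a::euclidean_space \<Rightarrow> complex) \<Rightarrow> ('a \<Rightarrow> complex) \<Rightarrow> 'a \<Rightarrow> complex" where
  "reflected_conv \<Phi> \<psi> y = (\<integral>x. \<Phi> (x - y) * \<psi> x \<partial>lborel)"

lemma GS_conv_eq: "GS_conv u \<Phi> \<psi> = u (reflected_conv \<Phi> \<psi>)"
  unfolding GS_conv_def reflected_conv_def ..

lemma exp_decay_weight:
  assumes d: "exp_decay f" and k: "k > 0"
  shows "exp_decay (\<lambda>x. f x * of_real (exp (k * norm x)))"
proof (rule exp_decayI)
  fix h :: real assume "h > 0"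
  then have "h + k > 0" using k by simp
  from exp_decayD[OF d this] obtain C where C: "C \<ge> 0" "\<And>x. norm (f x) \<le> C * exp (- (h + k) * norm x)"
    by blast
  have "norm (f x * of_real (exp (k * norm x))) \<le> C * exp (- h * norm x)" for x
  proof -
    have "norm (f x * of_real (exp (k * norm x))) \<le> C * exp (- (h + k) * norm x) * exp (k * norm x)"
      using C(2)[of x] by (simp add: norm_mult)
    also have "\<dots> = C * exp (- h * norm x)"
      unfolding mult.assoc exp_add[symmetric] by (simp add: algebra_simps)
    finally show ?thesis .
  qed
  then show "\<exists>C\<ge>0. \<forall>x. norm (f x * of_real (exp (k * norm x))) \<le> C * exp (- h * norm x)"
    using C(1) by blast
qed

text \<open>
  Since \<open>exp (h \<bar>y\<bar>) \<le> exp (h \<bar>x - y\<bar>) exp (h \<bar>x\<bar>)\<close>, the weight can be shared between the two factors;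
  \<open>C\<close> is the \<open>L\<^sup>1\<close> norm of the weighted \<open>\<Phi>\<close>.  The constant is independent of \<open>\<psi>\<close>, so this is
  continuity in the seminorms of position type.
\<close>

lemma reflected_conv_bound:
  fixes \<Phi> :: "'a::euclidean_space \<Rightarrow> complex"
  assumes \<Phi>: "\<Phi> \<in> GS" and h: "h > 0"
  shows "\<exists>C\<ge>0. \<forall>\<psi> M. (\<forall>x. norm (\<psi> x * of_real (exp (h * norm x))) \<le> M)
    \<longrightarrow> (\<forall>y. norm (reflected_conv \<Phi> \<psi> y * of_real (exp (h * norm y))) \<le> C * M)"
proof -
  let ?w = "\<lambda>x::'a. \<Phi> x * of_real (exp (h * norm x))"
  note [measurable] = GS_measurable[OF \<Phi>]
  have w: "integrable lborel (\<lambda>x. norm (?w x))"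
    by (intro integrable_norm exp_decay_integrable exp_decay_weight GS_decay \<Phi> h) measurable
  let ?C = "\<integral>x. norm (?w x) \<partial>lborel"
  show ?thesis
  proof (intro exI[of _ ?C] conjI allI impI)
    fix \<psi> :: "'a \<Rightarrow> complex" and M y assume "\<forall>x. norm (\<psi> x * of_real (exp (h * norm x))) \<le> M"
    then have M: "norm (\<psi> x * of_real (exp (h * norm x))) \<le> M" for x by blast
    have wy: "integrable lborel (\<lambda>x. norm (?w (- y + 1 *\<^sub>R x)) * M)"
      by (intro integrable_mult_left integrable_lborel_affine[OF w]) simp
    have "norm (reflected_conv \<Phi> \<psi> y) * exp (h * norm y)
        \<le> (\<integral>x. norm (\<Phi> (x - y) * \<psi> x) \<partial>lborel) * exp (h * norm y)"
      unfolding reflected_conv_def by (intro mult_right_mono integral_norm_bound) simp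
    also have "\<dots> = (\<integral>x. norm (\<Phi> (x - y) * \<psi> x) * exp (h * norm y) \<partial>lborel)"
      by (rule integral_mult_left_zero[symmetric])
    also have "\<dots> \<le> (\<integral>x. norm (?w (- y + 1 *\<^sub>R x)) * M \<partial>lborel)"
    proof (rule integral_mono'[OF wy])
      fix x
      have "norm y \<le> norm (- y + 1 *\<^sub>R x) + norm x"
        using norm_triangle_ineq4[of "- y + 1 *\<^sub>R x" x] by simp
      then have "h * norm y \<le> h * (norm (- y + 1 *\<^sub>R x) + norm x)"
        by (rule mult_left_mono[OF _ less_imp_le[OF h]])
      then have "exp (h * norm y) \<le> exp (h * norm (- y + 1 *\<^sub>R x)) * exp (h * norm x)"
        by (simp only: exp_add[symmetric] exp_le_cancel_iff distrib_left)
      then have "norm (\<Phi> (x - y) * \<psi> x) * exp (h * norm y)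
          \<le> norm (\<Phi> (x - y) * \<psi> x) * (exp (h * norm (- y + 1 *\<^sub>R x)) * exp (h * norm x))"
        by (rule mult_left_mono) simp
      also have "\<dots> = norm (?w (- y + 1 *\<^sub>R x)) * norm (\<psi> x * of_real (exp (h * norm x)))"
        by (simp add: norm_mult)
      also have "\<dots> \<le> norm (?w (- y + 1 *\<^sub>R x)) * M"
        by (rule mult_left_mono[OF M norm_ge_zero])
      finally show "norm (\<Phi> (x - y) * \<psi> x) * exp (h * norm y) \<le> norm (?w (- y + 1 *\<^sub>R x)) * M" .
      show "0 \<le> norm (?w (- y + 1 *\<^sub>R x)) * M"
        by (intro mult_nonneg_nonneg norm_ge_zero order.trans[OF norm_ge_zero M[of 0]])
    qed
    also have "\<dots> = (\<integral>x. norm (?w (- y + 1 *\<^sub>R x)) \<partial>lborel) * M"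
      by (rule integral_mult_left_zero)
    also have "(\<integral>x. norm (?w (- y + 1 *\<^sub>R x)) \<partial>lborel) = ?C"
      by (subst (2) integral_lborel_affine[where t="- y" and c=1]) simp_all
    finally show "norm (reflected_conv \<Phi> \<psi> y * of_real (exp (h * norm y))) \<le> ?C * M"
      by (simp add: norm_mult)
  qed simp
qed

lemma continuous_on_reflected_conv:
  assumes \<Phi>: "\<Phi> \<in> GS" and \<psi>: "\<psi> \<in> GS"
  shows "continuous_on UNIV (reflected_conv \<Phi> \<psi>)"
proof -
  note [measurable] = GS_measurable[OF \<Phi>] GS_measurable[OF \<psi>]
  obtain B where B: "\<And>x. norm (\<Phi> x) \<le> B" using exp_decay_bounded[OF GS_decay[OF \<Phi>]] by blast
  show ?thesis
    unfolding reflected_conv_def[abs_def]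
  proof (rule continuous_on_integral_dominated)
    show "integrable lborel (\<lambda>x. B * norm (\<psi> x))"
      by (intro integrable_mult_right integrable_norm GS_integrable \<psi>)
    show "norm (\<Phi> (x - y) * \<psi> x) \<le> B * norm (\<psi> x)" for x y
      unfolding norm_mult by (intro mult_right_mono B norm_ge_zero)
    show "(\<lambda>x. \<Phi> (x - y) * \<psi> x) \<in> borel_measurable borel" for y by measurable
    show "continuous_on UNIV (\<lambda>y. \<Phi> (x - y) * \<psi> x)" for x
      by (intro continuous_on_mult continuous_on_const continuous_on_compose2[OF GS_continuous[OF \<Phi>]])
         (auto intro!: continuous_intros)
  qed
qed

text \<open>
  The convolution theorem; the reflection of \<open>\<Phi>\<close> shows as \<open>- \<omega>\<close>.  Boundedness of the transform of \<open>\<Phi>\<close>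
  makes this the continuity estimate in the seminorms of frequency type.
\<close>

lemma fourier_reflected_conv:
  fixes \<Phi> \<psi> :: "'a::euclidean_space \<Rightarrow> complex"
  assumes \<Phi>: "\<Phi> \<in> GS" and \<psi>: "\<psi> \<in> GS"
  shows "fourier (reflected_conv \<Phi> \<psi>) \<omega> = fourier \<Phi> (- \<omega>) * fourier \<psi> \<omega>"
proof -
  note [measurable] = GS_measurable[OF \<Phi>] GS_measurable[OF \<psi>]
  let ?H = "\<lambda>y x. \<Phi> (x - y) * \<psi> x * cis (- (2 * pi * (y \<bullet> \<omega>)))"
  obtain C where C: "C \<ge> 0" "\<And>x. norm (\<Phi> x) \<le> C * exp (- 1 * norm x)"
    using exp_decayD[OF GS_decay[OF \<Phi>], of 1] by auto
  obtain D where D: "D \<ge> 0" "\<And>x. norm (\<psi> x) \<le> D * exp (- 1 * norm x)"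
    using exp_decayD[OF GS_decay[OF \<psi>], of 1] by auto
  have int1: "integrable lborel (\<lambda>x::'a. C * D * exp (- (1/2) * norm x))"
    and int2: "integrable lborel (\<lambda>x::'a. exp (- (1/2) * norm x))"
    by (intro integrable_mult_right integrable_exp_neg_norm; simp)+
  have H: "integrable lborel (\<lambda>(y, x). ?H y x)"
  proof (rule integrable_lborel_pair_bound[OF _ int1 int2])
    show "(\<lambda>(y, x). ?H y x) \<in> borel_measurable (borel \<Otimes>\<^sub>M borel)" by measurable
    fix y x :: 'a
    have "norm y \<le> norm (x - y) + norm x"
      using norm_triangle_ineq4[of x "x - y"] by simp
    then have "- 1 * norm (x - y) + - 1 * norm x \<le> - (1/2) * norm y + - (1/2) * norm x"
      using norm_ge_zero[of "x - y"] by linarith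
    then have *: "exp (- 1 * norm (x - y)) * exp (- 1 * norm x) \<le> exp (- (1/2) * norm y) * exp (- (1/2) * norm x)"
      by (simp only: exp_add[symmetric] exp_le_cancel_iff)
    have "norm (?H y x) = norm (\<Phi> (x - y)) * norm (\<psi> x)" by (simp add: norm_mult)
    also have "\<dots> \<le> (C * exp (- 1 * norm (x - y))) * (D * exp (- 1 * norm x))"
      using C D by (intro mult_mono) auto
    also have "\<dots> = C * D * (exp (- 1 * norm (x - y)) * exp (- 1 * norm x))"
      by (simp only: mult_ac)
    also have "\<dots> \<le> C * D * (exp (- (1/2) * norm y) * exp (- (1/2) * norm x))"
      using * C(1) D(1) by (intro mult_left_mono) auto
    finally show "norm (case (y, x) of (y, x) \<Rightarrow> ?H y x) \<le> C * D * exp (- (1/2) * norm y) * exp (- (1/2) * norm x)"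
      by (simp only: mult.assoc prod.case)
  qed
  have "fourier (reflected_conv \<Phi> \<psi>) \<omega> = (\<integral>y. (\<integral>x. ?H y x \<partial>lborel) \<partial>lborel)"
    unfolding fourier_cis reflected_conv_def by (simp only: integral_mult_left_zero)
  also have "\<dots> = (\<integral>x. (\<integral>y. ?H y x \<partial>lborel) \<partial>lborel)"
    using integral_lborel_swap[OF H] by simp
  also have "\<dots> = (\<integral>x. fourier \<Phi> (- \<omega>) * (\<psi> x * cis (- (2 * pi * (x \<bullet> \<omega>)))) \<partial>lborel)"
  proof (rule Bochner_Integration.integral_cong[OF refl])
    fix x
    have "(\<integral>y. ?H y x \<partial>lborel) = (\<integral>u. ?H (x + (- 1) *\<^sub>R u) x \<partial>lborel)"
      by (subst integral_lborel_affine[where t=x and c="-1"]) simp_all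
    also have "\<dots> = (\<integral>u. \<psi> x * cis (- (2 * pi * (x \<bullet> \<omega>))) * (\<Phi> u * cis (- (2 * pi * (u \<bullet> - \<omega>)))) \<partial>lborel)"
    proof (rule Bochner_Integration.integral_cong[OF refl])
      fix u
      have 1: "cis (- (2 * pi * ((x + (- 1) *\<^sub>R u) \<bullet> \<omega>))) = cis (- (2 * pi * (x \<bullet> \<omega>))) * cis (- (2 * pi * (u \<bullet> - \<omega>)))"
        by (simp add: cis_mult inner_diff_left algebra_simps)
      show "?H (x + (- 1) *\<^sub>R u) x = \<psi> x * cis (- (2 * pi * (x \<bullet> \<omega>))) * (\<Phi> u * cis (- (2 * pi * (u \<bullet> - \<omega>))))"
        unfolding 1 by simp
    qed
    also have "\<dots> = fourier \<Phi> (- \<omega>) * (\<psi> x * cis (- (2 * pi * (x \<bullet> \<omega>))))"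
      unfolding fourier_cis by (simp only: integral_mult_right_zero mult.commute)
    finally show "(\<integral>y. ?H y x \<partial>lborel) = fourier \<Phi> (- \<omega>) * (\<psi> x * cis (- (2 * pi * (x \<bullet> \<omega>))))" .
  qed
  also have "\<dots> = fourier \<Phi> (- \<omega>) * fourier \<psi> \<omega>"
    unfolding fourier_cis[of \<psi>] by (rule integral_mult_right_zero)
  finally show ?thesis .
qed

lemma exp_norm_upper:
  assumes "exp_decay f" "h > 0"
  shows "norm (f x * of_real (exp (h * norm x))) \<le> exp_norm h f"
proof -
  have "bounded (range (\<lambda>x. f x * of_real (exp (h * norm x))))"
    using assms exp_decay_iff_bounded by blast
  then have "bdd_above (range (\<lambda>x. norm (f x * of_real (exp (h * norm x)))))"
    unfolding bdd_above_def bounded_iff by auto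
  then show ?thesis unfolding exp_norm_def by (rule cSUP_upper[OF UNIV_I])
qed

lemma exp_norm_least:
  assumes "\<And>x. norm (f x * of_real (exp (h * norm x))) \<le> M"
  shows "exp_norm h f \<le> M"
  unfolding exp_norm_def using assms by (intro cSUP_least) auto

lemma exp_norm_zero: "exp_norm h (\<lambda>x. 0) = 0"
  unfolding exp_norm_def by simp

lemma exp_norm_add:
  assumes f: "exp_decay f" and g: "exp_decay g" and h: "h > 0"
  shows "exp_norm h (\<lambda>x. f x + g x) \<le> exp_norm h f + exp_norm h g"
proof (rule exp_norm_least)
  fix x
  show "norm ((f x + g x) * of_real (exp (h * norm x))) \<le> exp_norm h f + exp_norm h g"
    unfolding distrib_right
    by (rule order.trans[OF norm_triangle_ineq add_mono[OF exp_norm_upper[OF f h] exp_norm_upper[OF g h]]])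
qed

lemma GS_reflected_conv:
  fixes \<Phi> \<psi> :: "'a::euclidean_space \<Rightarrow> complex"
  assumes \<Phi>: "\<Phi> \<in> GS" and \<psi>: "\<psi> \<in> GS"
  shows "reflected_conv \<Phi> \<psi> \<in> GS"
  unfolding GS_iff
proof (intro conjI)
  show "continuous_on UNIV (reflected_conv \<Phi> \<psi>)" by (rule continuous_on_reflected_conv[OF \<Phi> \<psi>])
  show "exp_decay (reflected_conv \<Phi> \<psi>)"
    unfolding exp_decay_iff_bounded
  proof (intro allI impI)
    fix h :: real assume h: "h > 0"
    obtain C where C: "C \<ge> 0" "\<And>\<psi> M y. (\<And>x. norm (\<psi> x * of_real (exp (h * norm x))) \<le> M)
      \<Longrightarrow> norm (reflected_conv \<Phi> \<psi> y * of_real (exp (h * norm y))) \<le> C * M"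
      using reflected_conv_bound[OF \<Phi> h] by (elim exE conjE) (rule that, assumption, blast)
    show "bounded (range (\<lambda>x. reflected_conv \<Phi> \<psi> x * of_real (exp (h * norm x))))"
      unfolding bounded_iff using C(2)[OF exp_norm_upper[OF GS_decay[OF \<psi>] h]] by blast
  qed
  have "exp_decay (\<lambda>\<omega>. fourier \<Phi> (0 + (- 1) *\<^sub>R \<omega>) * fourier \<psi> \<omega>)"
    by (rule exp_decay_mult[OF exp_decay_affine GS_fourier_decay]) (use GS_fourier_decay \<Phi> \<psi> in auto)
  then show "exp_decay (fourier (reflected_conv \<Phi> \<psi>))"
    by (rule exp_decay_cong_norm) (simp add: fourier_reflected_conv[OF \<Phi> \<psi>])
qed

lemma reflected_conv_add:
  assumes \<Phi>: "\<Phi> \<in> GS" and f: "f \<in> GS" and g: "g \<in> GS"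
  shows "reflected_conv \<Phi> (\<lambda>x. f x + g x) = (\<lambda>y. reflected_conv \<Phi> f y + reflected_conv \<Phi> g y)"
proof
  fix y
  obtain B where B: "\<And>x. norm (\<Phi> x) \<le> B" using exp_decay_bounded[OF GS_decay[OF \<Phi>]] by blast
  have int: "integrable lborel (\<lambda>x. \<Phi> (x - y) * f x)" if f: "f \<in> GS" for f
  proof (rule Bochner_Integration.integrable_bound)
    note [measurable] = GS_measurable[OF \<Phi>] GS_measurable[OF f]
    show "integrable lborel (\<lambda>x. B * norm (f x))"
      by (intro integrable_mult_right integrable_norm GS_integrable f)
    show "(\<lambda>x. \<Phi> (x - y) * f x) \<in> borel_measurable lborel" by measurable
    have "norm (\<Phi> (x - y) * f x) \<le> B * norm (f x)" for x
      unfolding norm_mult by (intro mult_right_mono B norm_ge_zero)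
    then show "AE x in lborel. norm (\<Phi> (x - y) * f x) \<le> norm (B * norm (f x))"
      by (intro AE_I2) (metis abs_ge_self order.trans real_norm_def)
  qed
  show "reflected_conv \<Phi> (\<lambda>x. f x + g x) y = reflected_conv \<Phi> f y + reflected_conv \<Phi> g y"
    unfolding reflected_conv_def distrib_left by (rule Bochner_Integration.integral_add[OF int[OF f] int[OF g]])
qed

lemma reflected_conv_cmult:
  "reflected_conv \<Phi> (\<lambda>x. c * f x) = (\<lambda>y. c * reflected_conv \<Phi> f y)"
  unfolding reflected_conv_def[abs_def] mult.left_commute[of _ c] by simp

lemma GS_diff: "f \<in> GS \<Longrightarrow> g \<in> GS \<Longrightarrow> (\<lambda>x. f x - g x) \<in> GS"
  using GS_add[of f "\<lambda>x. -1 * g x"] GS_cmult[of g "-1"] by simp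

lemma topspace_GS_topology: "topspace GS_topology = (GS :: ('a::euclidean_space \<Rightarrow> complex) set)"
proof
  show "topspace GS_topology \<subseteq> (GS :: ('a \<Rightarrow> complex) set)"
    unfolding GS_topology_def topology_generated_by_topspace by blast
  show "(GS :: ('a \<Rightarrow> complex) set) \<subseteq> topspace GS_topology"
  proof
    fix f :: "'a \<Rightarrow> complex" assume f: "f \<in> GS"
    let ?U = "{g \<in> GS. exp_norm 1 (\<lambda>x. g x - f x) < 1}"
    have "f \<in> ?U" using f by (simp add: exp_norm_zero)
    moreover have "?U \<in> {{g \<in> GS. exp_norm h (\<lambda>x. g x - f x) < \<epsilon>} | f h \<epsilon>. f \<in> GS \<and> h > 0 \<and> \<epsilon> > 0}"
      by (intro CollectI exI[of _ f] exI[of _ "1::real"] conjI refl f zero_less_one)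
    ultimately show "f \<in> topspace GS_topology"
      unfolding GS_topology_def topology_generated_by_topspace by (meson UnI1 UnionI)
  qed
qed

text \<open>
  The topology is generated by the balls of two families of seminorms, \<open>exp_norm h\<close> and
  \<open>\<lambda>u. exp_norm h (fourier u)\<close>.  Continuity of \<open>T\<close> is the same triangle inequality argument for both
  families, so it is carried out once for an abstract seminorm \<open>Q\<close>.
\<close>

lemma openin_GS_preimage:
  fixes T :: "('a::euclidean_space \<Rightarrow> complex) \<Rightarrow> 'a \<Rightarrow> complex"
    and Q :: "('a \<Rightarrow> complex) \<Rightarrow> real"
  assumes T: "\<And>u. u \<in> GS \<Longrightarrow> T u \<in> GS"
    and T_add: "\<And>u v. u \<in> GS \<Longrightarrow> v \<in> GS \<Longrightarrow> T (\<lambda>x. u x + v x) = (\<lambda>x. T u x + T v x)"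
    and Q_zero: "Q (\<lambda>x. 0) = 0"
    and Q_add: "\<And>u v. u \<in> GS \<Longrightarrow> v \<in> GS \<Longrightarrow> Q (\<lambda>x. u x + v x) \<le> Q u + Q v"
    and C: "C \<ge> 0" and bound: "\<And>u. u \<in> GS \<Longrightarrow> Q (T u) \<le> C * Q u"
    and ball: "\<And>u e. u \<in> GS \<Longrightarrow> e > 0 \<Longrightarrow> openin GS_topology {g \<in> GS. Q (\<lambda>x. g x - u x) < e}"
    and f: "f \<in> GS"
  shows "openin GS_topology {u \<in> GS. Q (\<lambda>x. T u x - f x) < e}"
proof (subst openin_subopen, intro ballI)
  fix u assume "u \<in> {u \<in> GS. Q (\<lambda>x. T u x - f x) < e}"
  then have u: "u \<in> GS" and e: "Q (\<lambda>x. T u x - f x) < e" by auto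
  \<comment> \<open>The denominator is \<open>C + 1\<close> rather than \<open>C\<close> because \<open>C\<close> may vanish.\<close>
  let ?d = "(e - Q (\<lambda>x. T u x - f x)) / (C + 1)"
  have d: "?d > 0" using e C by simp
  have "{g \<in> GS. Q (\<lambda>x. g x - u x) < ?d} \<subseteq> {u \<in> GS. Q (\<lambda>x. T u x - f x) < e}"
  proof safe
    fix g assume g: "g \<in> GS" and less: "Q (\<lambda>x. g x - u x) < ?d"
    have gu: "(\<lambda>x. g x - u x) \<in> GS" by (rule GS_diff[OF g u])
    have "T g = (\<lambda>x. T u x + T (\<lambda>x. g x - u x) x)"
      using T_add[OF u gu] by simp
    then have "Q (\<lambda>x. T g x - f x) = Q (\<lambda>x. T (\<lambda>x. g x - u x) x + (T u x - f x))"
      by (simp add: algebra_simps)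
    also have "\<dots> \<le> Q (T (\<lambda>x. g x - u x)) + Q (\<lambda>x. T u x - f x)"
      by (rule Q_add[OF T[OF gu] GS_diff[OF T[OF u] f]])
    also have "\<dots> \<le> C * Q (\<lambda>x. g x - u x) + Q (\<lambda>x. T u x - f x)"
      using bound[OF gu] by simp
    also have "\<dots> \<le> C * ?d + Q (\<lambda>x. T u x - f x)"
      using less C by (intro add_right_mono mult_left_mono) auto
    also have "\<dots> < (C + 1) * ?d + Q (\<lambda>x. T u x - f x)"
      using d unfolding distrib_right mult_1_left by linarith
    also have "\<dots> = e" using C by simp
    finally show "Q (\<lambda>x. T g x - f x) < e" .
  qed
  moreover have "u \<in> {g \<in> GS. Q (\<lambda>x. g x - u x) < ?d}"
    using u d Q_zero by simp
  ultimately show "\<exists>U. openin GS_topology U \<and> u \<in> U \<and> U \<subseteq> {u \<in> GS. Q (\<lambda>x. T u x - f x) < e}"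
    using ball[OF u d] by blast
qed

lemma continuous_map_reflected_conv:
  fixes \<Phi> :: "'a::euclidean_space \<Rightarrow> complex"
  assumes \<Phi>: "\<Phi> \<in> GS"
  shows "continuous_map GS_topology GS_topology (reflected_conv \<Phi>)"
proof -
  let ?S1 = "{{g \<in> GS. exp_norm h (\<lambda>x. g x - f x) < \<epsilon>} | f h \<epsilon>. f \<in> (GS :: ('a \<Rightarrow> complex) set) \<and> h > 0 \<and> \<epsilon> > 0}"
  let ?S2 = "{{g \<in> GS. exp_norm h (fourier (\<lambda>x. g x - f x)) < \<epsilon>} | f h \<epsilon>. f \<in> (GS :: ('a \<Rightarrow> complex) set) \<and> h > 0 \<and> \<epsilon> > 0}"
  have S: "(GS_topology :: ('a \<Rightarrow> complex) topology) = topology_generated_by (?S1 \<union> ?S2)"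
    by (rule GS_topology_def)
  have open_sub: "openin GS_topology U" if "U \<in> ?S1 \<union> ?S2" for U
    unfolding S by (rule topology_generated_by_Basis[OF that])
  have T: "reflected_conv \<Phi> u \<in> GS" if "u \<in> GS" for u by (rule GS_reflected_conv[OF \<Phi> that])
  have o1: "openin GS_topology {u \<in> GS. exp_norm h (\<lambda>x. reflected_conv \<Phi> u x - f x) < e}"
    if f: "f \<in> GS" and h: "h > 0" for f h e
  proof -
    obtain C where C: "C \<ge> 0" "\<And>\<psi> M y. (\<And>x. norm (\<psi> x * of_real (exp (h * norm x))) \<le> M)
      \<Longrightarrow> norm (reflected_conv \<Phi> \<psi> y * of_real (exp (h * norm y))) \<le> C * M"
      using reflected_conv_bound[OF \<Phi> h] by (elim exE conjE) (rule that, assumption, blast)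
    show ?thesis
    proof (rule openin_GS_preimage[where Q="exp_norm h" and C=C])
      show "exp_norm h (reflected_conv \<Phi> u) \<le> C * exp_norm h u" if "u \<in> GS" for u
        by (intro exp_norm_least C(2) exp_norm_upper GS_decay that h)
      show "openin GS_topology {g \<in> GS. exp_norm h (\<lambda>x. g x - u x) < d}" if "u \<in> GS" "d > 0" for u :: "'a \<Rightarrow> complex" and d
        by (rule open_sub) (use that h in blast)
    qed (use T C(1) f in \<open>auto intro!: exp_norm_add GS_decay h simp: exp_norm_zero reflected_conv_add[OF \<Phi>]\<close>)
  qed
  have o2: "openin GS_topology {u \<in> GS. exp_norm h (fourier (\<lambda>x. reflected_conv \<Phi> u x - f x)) < e}"
    if f: "f \<in> GS" and h: "h > 0" for f h e
  proof -
    obtain B where B: "\<And>\<omega>. norm (fourier \<Phi> \<omega>) \<le> B"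
      using exp_decay_bounded[OF GS_fourier_decay[OF \<Phi>]] by blast
    have B0: "B \<ge> 0" by (rule order.trans[OF norm_ge_zero B])
    show ?thesis
    proof (rule openin_GS_preimage[where Q="\<lambda>u. exp_norm h (fourier u)" and C=B])
      show "exp_norm h (fourier (reflected_conv \<Phi> u)) \<le> B * exp_norm h (fourier u)" if u: "u \<in> GS" for u
      proof (rule exp_norm_least)
        fix \<omega>
        show "norm (fourier (reflected_conv \<Phi> u) \<omega> * of_real (exp (h * norm \<omega>))) \<le> B * exp_norm h (fourier u)"
          unfolding fourier_reflected_conv[OF \<Phi> u] mult.assoc norm_mult[of "fourier \<Phi> (- \<omega>)"]
          by (intro mult_mono B B0 norm_ge_zero exp_norm_upper GS_fourier_decay u h)
      qed
      show "openin GS_topology {g \<in> GS. exp_norm h (fourier (\<lambda>x. g x - u x)) < d}" if "u \<in> GS" "d > 0" for u :: "'a \<Rightarrow> complex" and d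
        by (rule open_sub) (use that h in blast)
      show "exp_norm h (fourier (\<lambda>x. 0)) = 0"
        by (simp add: fourier_cis[abs_def] exp_norm_zero)
      show "exp_norm h (fourier (\<lambda>x. u x + v x)) \<le> exp_norm h (fourier u) + exp_norm h (fourier v)"
        if u: "u \<in> GS" and v: "v \<in> GS" for u v
      proof -
        have "fourier (\<lambda>x. u x + v x) = (\<lambda>\<omega>. fourier u \<omega> + fourier v \<omega>)"
          by (intro ext fourier_add GS_integrable u v)
        then show ?thesis by (simp add: exp_norm_add GS_fourier_decay u v h)
      qed
    qed (use T B0 f in \<open>auto simp: reflected_conv_add[OF \<Phi>]\<close>)
  qed
  have "openin GS_topology (reflected_conv \<Phi> -` U \<inter> topspace GS_topology)" if U: "U \<in> ?S1 \<union> ?S2" for U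
    using U
  proof
    assume "U \<in> ?S1"
    then obtain f h e where U: "U = {g \<in> GS. exp_norm h (\<lambda>x. g x - f x) < e}" and f: "f \<in> GS" and h: "h > 0"
      by blast
    have "reflected_conv \<Phi> -` U \<inter> topspace GS_topology = {u \<in> GS. exp_norm h (\<lambda>x. reflected_conv \<Phi> u x - f x) < e}"
      unfolding U topspace_GS_topology using T by auto
    then show ?thesis using o1[OF f h] by simp
  next
    assume "U \<in> ?S2"
    then obtain f h e where U: "U = {g \<in> GS. exp_norm h (fourier (\<lambda>x. g x - f x)) < e}" and f: "f \<in> GS" and h: "h > 0"
      by blast
    have "reflected_conv \<Phi> -` U \<inter> topspace GS_topology = {u \<in> GS. exp_norm h (fourier (\<lambda>x. reflected_conv \<Phi> u x - f x)) < e}"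
      unfolding U topspace_GS_topology using T by auto
    then show ?thesis using o2[OF f h] by simp
  qed
  moreover have "reflected_conv \<Phi> ` topspace GS_topology \<subseteq> \<Union> (?S1 \<union> ?S2)"
  proof -
    have "reflected_conv \<Phi> ` topspace GS_topology \<subseteq> topspace GS_topology"
      unfolding topspace_GS_topology using T by auto
    also have "topspace GS_topology = \<Union> (?S1 \<union> ?S2)"
      unfolding S by (rule topology_generated_by_topspace)
    finally show ?thesis .
  qed
  ultimately show ?thesis
    unfolding S[symmetric] by (subst (2) S, subst continuous_on_generated_topo_iff) blast
qed

lemma GS_conv_dual:
  fixes \<Phi> :: "'a::euclidean_space \<Rightarrow> complex"
  assumes u: "u \<in> GS_dual" and \<Phi>: "\<Phi> \<in> GS"
  shows "GS_conv u \<Phi> \<in> GS_dual"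
proof -
  have eq: "GS_conv u \<Phi> = u \<circ> reflected_conv \<Phi>" by (rule ext) (simp add: GS_conv_eq)
  have u': "\<forall>f\<in>GS. \<forall>g\<in>GS. u (\<lambda>x. f x + g x) = u f + u g"
    "\<forall>c. \<forall>f\<in>GS. u (\<lambda>x. c * f x) = c * u f" "continuous_map GS_topology euclidean u"
    using u unfolding GS_dual_def mem_Collect_eq by - (elim conjE, assumption)+
  note conv = GS_reflected_conv[OF \<Phi>]
  show ?thesis
    unfolding GS_dual_def
  proof (intro CollectI conjI ballI allI)
    fix f g :: "'a \<Rightarrow> complex" assume "f \<in> GS" "g \<in> GS"
    then show "GS_conv u \<Phi> (\<lambda>x. f x + g x) = GS_conv u \<Phi> f + GS_conv u \<Phi> g"
      by (simp only: GS_conv_eq reflected_conv_add[OF \<Phi>] u'(1)[rule_format, OF conv conv])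
  next
    fix c and f :: "'a \<Rightarrow> complex" assume "f \<in> GS"
    then show "GS_conv u \<Phi> (\<lambda>x. c * f x) = c * GS_conv u \<Phi> f"
      by (simp only: GS_conv_eq reflected_conv_cmult u'(2)[rule_format, OF conv])
  next
    show "continuous_map GS_topology euclidean (GS_conv u \<Phi>)"
      unfolding eq by (rule continuous_map_compose[OF continuous_map_reflected_conv[OF \<Phi>] u'(3)])
  qed
qed

section \<open>Localization operators as Weyl operators\<close>

text \<open>
  The two modulations contribute \<open>cis (2 \<pi> q \<bullet> ((x + t/2) - (x - t/2)))\<close>, that is, a character in \<open>t\<close> alone,
  which shifts the frequency.
\<close>

lemma wigner_covariance:
  "wigner f g ((x, \<omega>) - (p, q))
    = wigner (modulation q (translation p f)) (modulation q (translation p g)) (x, \<omega>)"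
proof -
  have "cis (2 * pi * (q \<bullet> (x + t /\<^sub>R 2))) * cnj (cis (2 * pi * (q \<bullet> (x - t /\<^sub>R 2)))) * cis (- (2 * pi * (t \<bullet> \<omega>)))
      = cis (- (2 * pi * (t \<bullet> (\<omega> - q))))" for t
    unfolding cis_cnj cis_mult by (rule arg_cong[of _ _ cis]) (simp add: inner_add_right inner_diff_right inner_commute[of q t] algebra_simps)
  from arg_cong[OF this, of "\<lambda>c. f (x - p + t /\<^sub>R 2) * cnj (g (x - p - t /\<^sub>R 2)) * c" for t]
  have 1: "f (x - p + t /\<^sub>R 2) * cnj (g (x - p - t /\<^sub>R 2)) * cis (- (2 * pi * (t \<bullet> (\<omega> - q))))
     = (cis (2 * pi * (q \<bullet> (x + t /\<^sub>R 2))) * f (x - p + t /\<^sub>R 2))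
       * cnj (cis (2 * pi * (q \<bullet> (x - t /\<^sub>R 2))) * g (x - p - t /\<^sub>R 2)) * cis (- (2 * pi * (t \<bullet> \<omega>)))" for t
    by (simp only: complex_cnj_mult mult_ac)
  have 2: "x + t /\<^sub>R 2 - p = x - p + t /\<^sub>R 2" "x - t /\<^sub>R 2 - p = x - p - t /\<^sub>R 2" for t
    by simp_all
  show ?thesis
    unfolding diff_Pair wigner_eq_fourier fourier_cis wigner_kernel_def modulation_cis translation_def 1 2 ..
qed

text \<open>
  The characters of the components multiply to a single one, because \<open>\<omega> \<bullet> t\<close> is the sum over the
  blocks; this brings covariance and Moyal's identity to bear.
\<close>

lemma multi_stft_tensor:
  "multi_stft \<phi> F (x, \<omega>) = (\<integral>t. F t * cnj (modulation \<omega> (translation x (tensor \<phi>)) t) \<partial>lborel)"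
proof -
  have "(\<Prod>j\<in>UNIV. modulation (\<omega> $ j) (translation (x $ j) (\<phi> j)) (t $ j))
      = modulation \<omega> (translation x (tensor \<phi>)) t" for t
    unfolding modulation_cis translation_def tensor_def prod.distrib inner_vec_def[of \<omega>]
    by (simp only: cis_sum[OF finite_class.finite_UNIV, symmetric] sum_distrib_left vector_minus_component)
  then show ?thesis
    unfolding multi_stft_def prod.case cnj_prod[symmetric] by simp
qed

text \<open>
  This identity of functions is the heart of the matter: the left side is what the Weyl operator with
  symbol \<open>GS_conv a (W (\<phi>2, \<phi>1))\<close> feeds to \<open>a\<close>, the right side is what the localization operator
  feeds to \<open>a\<close>.
\<close>

lemma reflected_conv_wigner:
  fixes f \<phi>1 \<phi>2 :: "'n::finite \<Rightarrow> real ^ 'd::finite \<Rightarrow> complex"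
  assumes \<phi>1: "\<And>j. \<phi>1 j \<in> GS" and \<phi>2: "\<And>j. \<phi>2 j \<in> GS" and f: "\<And>j. f j \<in> GS" and G: "G \<in> GS"
  shows "reflected_conv (wigner (tensor \<phi>2) (tensor \<phi>1)) (\<lambda>z. cnj (wigner G (tensor f) z))
    = (\<lambda>z. multi_stft \<phi>1 (tensor f) z * cnj (multi_stft \<phi>2 G z))"
proof
  fix z :: "(real ^ 'd ^ 'n) \<times> (real ^ 'd ^ 'n)"
  obtain p q where z: "z = (p, q)" by (cases z)
  let ?\<pi> = "\<lambda>\<phi>. modulation q (translation p (tensor \<phi>))"
  have \<pi>: "?\<pi> \<phi>1 \<in> GS" "?\<pi> \<phi>2 \<in> GS"
    by (intro GS_modulation GS_translation GS_tensor \<phi>1 \<phi>2)+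
  have "wigner (tensor \<phi>2) (tensor \<phi>1) (w - (p, q)) = wigner (?\<pi> \<phi>2) (?\<pi> \<phi>1) w" for w
    by (cases w) (simp only: wigner_covariance)
  then have "reflected_conv (wigner (tensor \<phi>2) (tensor \<phi>1)) (\<lambda>z. cnj (wigner G (tensor f) z)) z
      = (\<integral>w. wigner (?\<pi> \<phi>2) (?\<pi> \<phi>1) w * cnj (wigner G (tensor f) w) \<partial>lborel)"
    unfolding reflected_conv_def z by simp
  also have "\<dots> = (\<integral>t. ?\<pi> \<phi>2 t * cnj (G t) \<partial>lborel) * cnj (\<integral>t. ?\<pi> \<phi>1 t * cnj (tensor f t) \<partial>lborel)"
    by (rule wigner_moyal[OF \<pi>(2) \<pi>(1) G GS_tensor[OF f]])
  also have "\<dots> = cnj (multi_stft \<phi>2 G z) * multi_stft \<phi>1 (tensor f) z"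
    unfolding z multi_stft_tensor Bochner_Integration.integral_cnj[symmetric] by (simp add: mult.commute)
  finally show "reflected_conv (wigner (tensor \<phi>2) (tensor \<phi>1)) (\<lambda>z. cnj (wigner G (tensor f) z)) z
      = multi_stft \<phi>1 (tensor f) z * cnj (multi_stft \<phi>2 G z)"
    by (simp only: mult.commute)
qed

theorem theorem3p4:
  fixes a \<sigma> :: "((real ^ 'd::finite ^ 'n::finite) \<times> (real ^ 'd ^ 'n) \<Rightarrow> complex) \<Rightarrow> complex"
    and \<phi>1 \<phi>2 :: "'n \<Rightarrow> real ^ 'd \<Rightarrow> complex"
  assumes a: "a \<in> GS_dual"
    and \<phi>1: "\<And>j. \<phi>1 j \<in> GS"
    and \<phi>2: "\<And>j. \<phi>2 j \<in> GS"
    and \<sigma>: "\<sigma> = GS_conv a (wigner (tensor \<phi>2) (tensor \<phi>1))"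
  shows "wigner (tensor \<phi>2) (tensor \<phi>1) \<in> GS
    \<and> \<sigma> \<in> GS_dual
    \<and> \<sigma> = GS_conv a (\<lambda>(x, \<omega>). \<Prod>j\<in>UNIV. wigner (\<phi>2 j) (\<phi>1 j) (x $ j, \<omega> $ j))
    \<and> (\<forall>f. (\<forall>j. f j \<in> GS) \<longrightarrow>
          (\<forall>\<psi>\<in>GS. loc_op a \<phi>1 \<phi>2 f \<psi> = weyl_op \<sigma> f \<psi>))
    \<and> (\<forall>f g. (\<forall>j. f j \<in> GS) \<and> (\<forall>j. g j \<in> GS) \<longrightarrow>
          bracket (loc_op a \<phi>1 \<phi>2 f) (tensor g) = bracket (weyl_op \<sigma> f) (tensor g))"
proof -
  have W: "wigner (tensor \<phi>2) (tensor \<phi>1) \<in> GS"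
    by (intro GS_wigner GS_tensor \<phi>1 \<phi>2)
  have dual: "\<sigma> \<in> GS_dual" unfolding \<sigma> by (rule GS_conv_dual[OF a W])
  have "wigner (tensor \<phi>2) (tensor \<phi>1) = (\<lambda>(x, \<omega>). \<Prod>j\<in>UNIV. wigner (\<phi>2 j) (\<phi>1 j) (x $ j, \<omega> $ j))"
    by (rule ext) (auto simp: wigner_tensor[OF \<phi>2 \<phi>1])
  then have prod: "\<sigma> = GS_conv a (\<lambda>(x, \<omega>). \<Prod>j\<in>UNIV. wigner (\<phi>2 j) (\<phi>1 j) (x $ j, \<omega> $ j))"
    unfolding \<sigma> by (rule arg_cong)
  have op: "loc_op a \<phi>1 \<phi>2 f \<psi> = weyl_op \<sigma> f \<psi>" if f: "\<And>j. f j \<in> GS" and \<psi>: "\<psi> \<in> GS" for f \<psi>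
    unfolding loc_op_def weyl_op_def bracket_def \<sigma> GS_conv_eq
      reflected_conv_wigner[OF \<phi>1 \<phi>2 f GS_cnj[OF \<psi>]] by simp
  have "bracket (loc_op a \<phi>1 \<phi>2 f) (tensor g) = bracket (weyl_op \<sigma> f) (tensor g)"
    if "\<And>j. f j \<in> GS" "\<And>j. g j \<in> GS" for f g
    unfolding bracket_def[of _ "tensor g"] by (intro op GS_cnj GS_tensor that)
  with W dual prod op show ?thesis by blast
qed

end
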